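(* Let $d\ge1$ and let \[ p(x)=\sum_{i=0}^{d} x^{d-i}(-1)^i a_i,\qquad q(x)=\sum_{i=0}^{d} x^{d-i}(-1)^i b_i \] be monic polynomials of degree $d$ having only nonnegative real roots. Then \[ p(x)\boxplus\!\boxplus_d\, q(x)=\sum_{k=0}^{d} x^{d-k}(-1)^k\sum_{i+j=k}\left(\frac{(d-i)!\,(d-j)!}{d!\,(d-i-j)!}\right)^2 a_i b_j. \]
   Context: For a square matrix $M$, $\chi_M(x)=\det(xI-M)$. For monic degree-$d$ polynomials $p,q$ with only nonnegative real roots, choose real $d\times d$ matrices $A,B$ with $\chi_{AA^T}=p$ and $\chi_{BB^T}=q$; the asymmetric additive convolution is $p(x)\boxplus\!\boxplus_d\, q(x)=\mathbb{E}_{R,Q}\,\chi_{(A+RBQ)(A+RBQ)^T}(x)$, where $R,Q$ are independent Haar-random $d\times d$ real orthogonal matrices. *)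

theory Defs
  imports "HOL-Probability.Probability" "HOL-Computational_Algebra.Polynomial"
begin

definition charpoly :: "real^'n^'n \<Rightarrow> real poly" where
  "charpoly M = det (mat [:0, 1:] - map_matrix (\<lambda>c. [:c:]) M)"

text \<open>Haar probability on the real orthogonal group, represented as a Borel measure on the
  space of all matrices that is concentrated on the orthogonal ones. Existence, uniqueness and
  invariance on both sides are proved below.\<close>

definition is_haar_orthogonal :: "(real^'n^'n) measure \<Rightarrow> bool" where
  "is_haar_orthogonal \<mu> \<longleftrightarrow> prob_space \<mu> \<and> sets \<mu> = sets borel \<and>
     (AE U in \<mu>. orthogonal_matrix U) \<and>
     (\<forall>V. orthogonal_matrix V \<longrightarrow> distr \<mu> borel (\<lambda>U. V ** U) = \<mu>)"

definition haar_orthogonal :: "(real^'n^'n) measure" where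
  "haar_orthogonal = (THE \<mu>. is_haar_orthogonal \<mu>)"

lemma borel_measurable_matrix_mult [measurable (raw)]:
  fixes f :: "'a \<Rightarrow> real^'n^'m" and g :: "'a \<Rightarrow> real^'k^'n"
  assumes "f \<in> borel_measurable M" "g \<in> borel_measurable M"
  shows "(\<lambda>x. f x ** g x) \<in> borel_measurable M"
proof (rule borel_measurable_continuous_Pair[OF assms])
  show "continuous_on UNIV (\<lambda>z :: (real^'n^'m) \<times> (real^'k^'n). fst z ** snd z)"
    unfolding matrix_matrix_mult_def
    by (intro continuous_on_vec_lambda continuous_intros)
qed

lemma borel_measurable_transpose [measurable]:
  "(transpose :: real^'n^'m \<Rightarrow> _) \<in> borel_measurable borel"
  unfolding transpose_def
  by (intro borel_measurable_continuous_onI continuous_on_vec_lambda continuous_intros)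

lemma sets_orthogonal_matrix [measurable]:
  "{U :: real^'n^'n. orthogonal_matrix U} \<in> sets borel"
proof -
  have "{U :: real^'n^'n. orthogonal_matrix U} = (\<lambda>U. transpose U ** U) -` {mat 1} \<inter> space borel"
    by (auto simp: orthogonal_matrix)
  also have "\<dots> \<in> sets borel"
    by (intro measurable_sets[where A = borel]) auto
  finally show ?thesis .
qed

lemma haar_orthogonal_eq_transpose:
  fixes \<mu> \<nu> :: "(real^'n^'n) measure"
  assumes "is_haar_orthogonal \<mu>" "is_haar_orthogonal \<nu>"
  shows "\<mu> = distr \<nu> borel transpose"
proof (rule measure_eqI)
  interpret \<mu>: prob_space \<mu> using assms by (simp add: is_haar_orthogonal_def)
  interpret \<nu>: prob_space \<nu> using assms by (simp add: is_haar_orthogonal_def)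
  interpret \<mu>\<nu>: pair_sigma_finite \<mu> \<nu> ..
  have [measurable_cong]: "sets \<mu> = sets borel" "sets \<nu> = sets borel"
    using assms by (auto simp: is_haar_orthogonal_def)
  show "sets \<mu> = sets (distr \<nu> borel transpose)"
    by simp fact
  fix E assume "E \<in> sets \<mu>"
  hence E [measurable]: "E \<in> sets borel" by (simp add: \<open>sets \<mu> = sets borel\<close>)
  have 1: "(\<integral>\<^sup>+x. indicator E (transpose y ** x) \<partial>\<mu>) = emeasure \<mu> E"
    if "orthogonal_matrix y" for y
  proof -
    have "orthogonal_matrix (transpose y)" using that by simp
    hence "emeasure \<mu> E = emeasure (distr \<mu> borel (\<lambda>x. transpose y ** x)) E"
      using assms(1) by (simp add: is_haar_orthogonal_def)
    also have "\<dots> = (\<integral>\<^sup>+x. indicator E x \<partial>distr \<mu> borel (\<lambda>x. transpose y ** x))"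
      by simp
    also have "\<dots> = (\<integral>\<^sup>+x. indicator E (transpose y ** x) \<partial>\<mu>)"
      by (intro nn_integral_distr) auto
    finally show ?thesis by simp
  qed
  have 2: "(\<integral>\<^sup>+y. indicator E (transpose y ** x) \<partial>\<nu>) = emeasure (distr \<nu> borel transpose) E"
    if "orthogonal_matrix x" for x
  proof -
    have "orthogonal_matrix (transpose x)" using that by simp
    hence \<nu>: "distr \<nu> borel (\<lambda>y. transpose x ** y) = \<nu>"
      using assms(2) by (simp add: is_haar_orthogonal_def)
    have "emeasure (distr \<nu> borel transpose) E = (\<integral>\<^sup>+y. indicator E y \<partial>distr \<nu> borel transpose)"
      by simp
    also have "\<dots> = (\<integral>\<^sup>+y. indicator E (transpose y) \<partial>\<nu>)"
      by (intro nn_integral_distr) auto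
    also have "\<dots> = (\<integral>\<^sup>+y. indicator E (transpose y) \<partial>distr \<nu> borel (\<lambda>y. transpose x ** y))"
      by (simp only: \<nu>)
    also have "\<dots> = (\<integral>\<^sup>+y. indicator E (transpose (transpose x ** y)) \<partial>\<nu>)"
      by (intro nn_integral_distr) auto
    finally show ?thesis by (simp add: matrix_transpose_mul)
  qed
  have AE: "AE x in \<mu>. orthogonal_matrix x" "AE x in \<nu>. orthogonal_matrix x"
    using assms by (auto simp: is_haar_orthogonal_def)
  have "emeasure \<mu> E = (\<integral>\<^sup>+y. emeasure \<mu> E \<partial>\<nu>)"
    by (simp add: \<nu>.emeasure_space_1)
  also have "\<dots> = (\<integral>\<^sup>+y. \<integral>\<^sup>+x. indicator E (transpose y ** x) \<partial>\<mu> \<partial>\<nu>)"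
    by (intro nn_integral_cong_AE eventually_mono[OF AE(2)]) (simp add: 1)
  also have "\<dots> = (\<integral>\<^sup>+x. \<integral>\<^sup>+y. indicator E (transpose y ** x) \<partial>\<nu> \<partial>\<mu>)"
    by (intro \<mu>\<nu>.Fubini') measurable
  also have "\<dots> = (\<integral>\<^sup>+x. emeasure (distr \<nu> borel transpose) E \<partial>\<mu>)"
    by (intro nn_integral_cong_AE eventually_mono[OF AE(1)]) (simp add: 2)
  also have "\<dots> = emeasure (distr \<nu> borel transpose) E"
    by (simp add: \<mu>.emeasure_space_1)
  finally show "emeasure \<mu> E = emeasure (distr \<nu> borel transpose) E" .
qed

lemma is_haar_orthogonal_unique:
  "is_haar_orthogonal \<mu> \<Longrightarrow> is_haar_orthogonal \<nu> \<Longrightarrow> \<mu> = \<nu>"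
  using haar_orthogonal_eq_transpose[of \<mu> \<nu>] haar_orthogonal_eq_transpose[of \<nu> \<nu>] by simp

lemma is_haar_orthogonal_right_invariant:
  fixes \<mu> :: "(real^'n^'n) measure"
  assumes "is_haar_orthogonal \<mu>" "orthogonal_matrix V"
  shows "distr \<mu> borel (\<lambda>U. U ** V) = \<mu>"
proof -
  have [measurable_cong]: "sets \<mu> = sets borel"
    using assms by (auto simp: is_haar_orthogonal_def)
  have T: "distr \<mu> borel transpose = \<mu>"
    using haar_orthogonal_eq_transpose[OF assms(1) assms(1)] by simp
  have "distr \<mu> borel (\<lambda>U. U ** V) = distr (distr \<mu> borel transpose) borel (\<lambda>U. U ** V)"
    by (simp add: T)
  also have "\<dots> = distr \<mu> borel (\<lambda>U. transpose U ** V)"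
    by (subst distr_distr) (auto simp: o_def)
  also have "\<dots> = distr (distr \<mu> borel (\<lambda>U. transpose V ** U)) borel transpose"
    by (subst distr_distr) (auto simp: o_def matrix_transpose_mul)
  also have "distr \<mu> borel (\<lambda>U. transpose V ** U) = \<mu>"
    using assms by (simp add: is_haar_orthogonal_def)
  finally show ?thesis by (simp add: T)
qed

lemma lborel_distr_isometry:
  fixes f :: "'a::euclidean_space \<Rightarrow> 'a"
  assumes f: "orthogonal_transformation f"
  shows "distr lborel borel f = lborel"
proof (rule measure_eqI)
  define \<nu> where "\<nu> = distr lborel borel f"
  have lin: "linear f" using f by (simp add: orthogonal_transformation_linear)
  have f_meas [measurable]: "f \<in> borel_measurable borel"
    using lin by (intro borel_measurable_continuous_onI linear_continuous_on)
      (simp add: linear_conv_bounded_linear)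
  have [measurable_cong]: "sets \<nu> = sets borel" by (simp add: \<nu>_def)
  define B where "B = ball (0::'a) 1"
  have B [measurable]: "B \<in> sets borel" by (simp add: B_def)
  have vB: "f -` B = B"
    using f by (auto simp: B_def orthogonal_transformation_norm)
  have \<nu>B: "emeasure \<nu> B = emeasure lborel B"
    by (simp add: \<nu>_def emeasure_distr vB)
  have finB: "emeasure lborel B < \<infinity>" using emeasure_lborel_ball_finite[of "0::'a" 1] by (simp add: B_def)
  have posB: "emeasure lborel B \<noteq> 0"
    using content_ball_pos[of 1 "0::'a"] by (auto simp: B_def measure_def)
  have transl: "(\<integral>\<^sup>+x. h (y + x) \<partial>\<nu>) = (\<integral>\<^sup>+x. h x \<partial>\<nu>)"
    if h [measurable]: "h \<in> borel_measurable borel" for h :: "'a \<Rightarrow> ennreal" and y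
  proof -
    obtain z where z: "f z = y"
      using orthogonal_transformation_surj[OF f] by (metis surjD)
    have "(\<integral>\<^sup>+x. h (y + x) \<partial>\<nu>) = (\<integral>\<^sup>+x. h (y + f x) \<partial>lborel)"
      unfolding \<nu>_def by (intro nn_integral_distr) auto
    also have "\<dots> = (\<integral>\<^sup>+x. h (f (z + x)) \<partial>lborel)"
      by (simp add: z linear_add[OF lin])
    also have "\<dots> = (\<integral>\<^sup>+x. h (f x) \<partial>distr lborel borel ((+) z))"
      by (intro nn_integral_distr[symmetric]) auto
    also have "distr lborel borel ((+) z) = (lborel :: 'a measure)"
      by (rule lborel_distr_plus)
    also have "(\<integral>\<^sup>+x. h (f x) \<partial>lborel) = (\<integral>\<^sup>+x. h x \<partial>\<nu>)"
      unfolding \<nu>_def by (intro nn_integral_distr[symmetric]) auto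
    finally show ?thesis .
  qed
  have transl0: "(\<integral>\<^sup>+x. h (y + x) \<partial>lborel) = (\<integral>\<^sup>+x. h x \<partial>lborel)"
    if h [measurable]: "h \<in> borel_measurable borel" for h :: "'a \<Rightarrow> ennreal" and y
  proof -
    have "(\<integral>\<^sup>+x. h (y + x) \<partial>lborel) = (\<integral>\<^sup>+x. h x \<partial>distr lborel borel ((+) y))"
      by (intro nn_integral_distr[symmetric]) auto
    thus ?thesis by (simp add: lborel_distr_plus)
  qed
  have "sigma_finite_measure \<nu>"
  proof
    have "(\<Union>n. ball (0::'a) (real n)) = UNIV"
      by (auto simp: intro: reals_Archimedean2)
    moreover have "f -` ball 0 r = ball 0 r" for r
      using f by (auto simp: orthogonal_transformation_norm)
    hence "emeasure \<nu> (ball 0 r) \<noteq> \<infinity>" for r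
      using emeasure_lborel_ball_finite[of "0::'a" r] by (simp add: \<nu>_def emeasure_distr)
    ultimately show "\<exists>A. countable A \<and> A \<subseteq> sets \<nu> \<and> \<Union> A = space \<nu> \<and> (\<forall>a\<in>A. emeasure \<nu> a \<noteq> \<infinity>)"
      by (intro exI[of _ "range (\<lambda>n. ball (0::'a) (real n))"]) (auto simp: \<nu>_def)
  qed
  then interpret \<nu>: sigma_finite_measure \<nu> .
  interpret P: pair_sigma_finite "lborel :: 'a measure" \<nu> ..
  show "sets (distr lborel borel f) = sets lborel" by simp
  fix A assume "A \<in> sets (distr lborel borel f)"
  hence A [measurable]: "A \<in> sets borel" by simp
  have "emeasure lborel A * emeasure \<nu> B = (\<integral>\<^sup>+y. \<integral>\<^sup>+x. indicator B y * indicator A x \<partial>lborel \<partial>\<nu>)"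
    by (simp add: nn_integral_cmult nn_integral_multc mult.commute)
  also have "\<dots> = (\<integral>\<^sup>+y. \<integral>\<^sup>+x. indicator B y * indicator A (y + x) \<partial>lborel \<partial>\<nu>)"
    by (intro nn_integral_cong transl0[symmetric]) measurable
  also have "\<dots> = (\<integral>\<^sup>+x. \<integral>\<^sup>+y. indicator B y * indicator A (y + x) \<partial>\<nu> \<partial>lborel)"
    by (intro P.Fubini') measurable
  also have "\<dots> = (\<integral>\<^sup>+x. \<integral>\<^sup>+y. indicator B (y - x) * indicator A y \<partial>\<nu> \<partial>lborel)"
  proof (rule nn_integral_cong)
    fix x :: 'a
    show "(\<integral>\<^sup>+y. indicator B y * indicator A (y + x) \<partial>\<nu>) =
          (\<integral>\<^sup>+y. indicator B (y - x) * indicator A y \<partial>\<nu>)"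
      using transl[of "\<lambda>y. indicator B (y - x) * indicator A y" x] by (simp add: add.commute)
  qed
  also have "\<dots> = (\<integral>\<^sup>+y. \<integral>\<^sup>+x. indicator B (y - x) * indicator A y \<partial>lborel \<partial>\<nu>)"
    by (intro P.Fubini'[symmetric]) measurable
  also have "\<dots> = (\<integral>\<^sup>+y. emeasure lborel B * indicator A y \<partial>\<nu>)"
  proof (rule nn_integral_cong)
    fix y :: 'a
    have "(\<integral>\<^sup>+x. indicator B (y - x) \<partial>lborel) = (\<integral>\<^sup>+x. indicator B (y - (y + x)) \<partial>lborel)"
      by (rule transl0[symmetric]) measurable
    also have "\<dots> = (\<integral>\<^sup>+x. indicator B x \<partial>lborel)"
      by (intro nn_integral_cong) (auto simp: B_def indicator_def)
    finally show "(\<integral>\<^sup>+x. indicator B (y - x) * indicator A y \<partial>lborel) =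
        emeasure lborel B * indicator A y"
      by (simp add: nn_integral_multc)
  qed
  also have "\<dots> = emeasure lborel B * emeasure \<nu> A"
    by (simp add: nn_integral_cmult)
  finally have "emeasure lborel B * emeasure lborel A = emeasure lborel B * emeasure \<nu> A"
    by (simp add: \<nu>B mult.commute)
  thus "emeasure (distr lborel borel f) A = emeasure lborel A"
    using finB posB by (auto simp: \<nu>_def[symmetric] ennreal_mult_cancel_left)
qed

text \<open>Gram--Schmidt on the columns of a matrix, in the order given by an enumeration \<open>e\<close>.\<close>

fun gram_schmidt_col :: "(nat \<Rightarrow> 'n) \<Rightarrow> real^'n^'n \<Rightarrow> nat \<Rightarrow> real^'n" where
  "gram_schmidt_col e X k =
     (let w = column (e k) X - (\<Sum>j\<in>set [0..<k].
                (gram_schmidt_col e X j \<bullet> column (e k) X) *\<^sub>R gram_schmidt_col e X j)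
      in w /\<^sub>R norm w)"

declare gram_schmidt_col.simps [simp del]

lemma gram_schmidt_col_equivariant:
  assumes "orthogonal_matrix V"
  shows "gram_schmidt_col e (V ** X) k = V *v gram_schmidt_col e X k"
proof (induction k rule: less_induct)
  case (less k)
  have ot: "orthogonal_transformation ((*v) V)"
    using assms by (simp add: orthogonal_transformation_matrix)
  have col: "column i (V ** X) = V *v column i X" for i
    by (simp add: vec_eq_iff column_def matrix_matrix_mult_def matrix_vector_mult_def)
  have inn: "(V *v x) \<bullet> (V *v y) = x \<bullet> y" for x y
    using ot by (simp add: orthogonal_transformation_def)
  have nrm: "norm (V *v x) = norm x" for x
    using ot by (simp add: orthogonal_transformation_norm)
  define w where "w = column (e k) X - (\<Sum>j\<in>set [0..<k].
                (gram_schmidt_col e X j \<bullet> column (e k) X) *\<^sub>R gram_schmidt_col e X j)"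
  have "column (e k) (V ** X) - (\<Sum>j\<in>set [0..<k].
          (gram_schmidt_col e (V ** X) j \<bullet> column (e k) (V ** X)) *\<^sub>R gram_schmidt_col e (V ** X) j)
        = V *v w"
    by (simp add: w_def less.IH col inn linear_diff[OF matrix_vector_mul_linear]
         linear_sum[OF matrix_vector_mul_linear] linear_cmul[OF matrix_vector_mul_linear])
  hence "gram_schmidt_col e (V ** X) k = (V *v w) /\<^sub>R norm (V *v w)"
    by (simp add: gram_schmidt_col.simps[of _ _ k] Let_def)
  also have "\<dots> = V *v (w /\<^sub>R norm w)"
    by (simp add: nrm linear_cmul[OF matrix_vector_mul_linear])
  also have "w /\<^sub>R norm w = gram_schmidt_col e X k"
    by (simp add: gram_schmidt_col.simps[of _ _ k] w_def Let_def)
  finally show ?case .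
qed

lemma gram_schmidt_col_measurable [measurable]:
  "(\<lambda>X. gram_schmidt_col e X k) \<in> borel_measurable borel"
proof (induction k rule: less_induct)
  case (less k)
  have col [measurable]: "(\<lambda>X :: real^'b^'b. column i X) \<in> borel_measurable borel" for i
    unfolding column_def
    by (intro borel_measurable_continuous_onI continuous_on_vec_lambda continuous_intros)
  have [measurable]: "(\<lambda>X. \<Sum>j\<in>set [0..<k].
      (gram_schmidt_col e X j \<bullet> column (e k) X) *\<^sub>R gram_schmidt_col e X j) \<in> borel_measurable borel"
    using less.IH
    by (intro borel_measurable_sum borel_measurable_scaleR borel_measurable_inner) auto
  show ?case
    unfolding gram_schmidt_col.simps[of _ _ k] Let_def by measurable
qed

lemma gram_schmidt_col_orthonormal:
  fixes X :: "real^'n^'n"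
  assumes e: "bij_betw e {..<CARD('n)} UNIV" and X: "det X \<noteq> 0"
  assumes "k < CARD('n)"
  shows "norm (gram_schmidt_col e X k) = 1 \<and>
         (\<forall>j<k. gram_schmidt_col e X j \<bullet> gram_schmidt_col e X k = 0) \<and>
         gram_schmidt_col e X k \<in> span ((\<lambda>i. column (e i) X) ` {..k})"
  using assms(3)
proof (induction k rule: less_induct)
  case (less k)
  define g where "g = gram_schmidt_col e X"
  define c where "c = (\<lambda>i. column (e i) X)"
  define w where "w = c k - (\<Sum>j<k. (g j \<bullet> c k) *\<^sub>R g j)"
  have gk: "g k = w /\<^sub>R norm w"
    by (simp add: g_def gram_schmidt_col.simps[of _ _ k] Let_def w_def c_def
          atLeast0LessThan)
  have IH1: "norm (g j) = 1" and IH2: "\<And>i. i < j \<Longrightarrow> g i \<bullet> g j = 0"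
    and IH3: "g j \<in> span (c ` {..j})" if "j < k" for j
    using less.IH[of j] less.prems that by (auto simp: g_def c_def)
  have gspan: "g j \<in> span (c ` {..<k})" if "j < k" for j
  proof -
    have "c ` {..j} \<subseteq> c ` {..<k}" using that by (intro image_mono) auto
    thus ?thesis using IH3[OF that] span_mono by blast
  qed
  have S: "(\<Sum>j<k. (g j \<bullet> c k) *\<^sub>R g j) \<in> span (c ` {..<k})"
    by (intro span_sum span_scale gspan) auto
  have inj: "inj (\<lambda>i. column i X)" and ind: "independent (columns X)"
  proof -
    show "inj (\<lambda>i. column i X)"
      using X det_identical_columns[of _ _ X] by (auto simp: inj_def)
    show "independent (columns X)"
      using X det_dependent_columns[of X] dependent_vec_eq by blast
  qed
  have "c k \<notin> span (c ` {..<k})"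
  proof
    assume *: "c k \<in> span (c ` {..<k})"
    have "c ` {..<k} \<subseteq> columns X - {c k}"
    proof
      fix v assume "v \<in> c ` {..<k}"
      then obtain j where j: "j < k" "v = c j" by auto
      have "e j \<noteq> e k"
        using e j less.prems by (auto simp: bij_betw_def inj_on_def)
      hence "c j \<noteq> c k" using inj by (auto simp: c_def inj_def)
      thus "v \<in> columns X - {c k}" using j by (auto simp: c_def columns_def)
    qed
    hence "c k \<in> span (columns X - {c k})" using * span_mono by blast
    moreover have "c k \<in> columns X" by (auto simp: c_def columns_def)
    ultimately show False using ind by (auto simp: dependent_def)
  qed
  hence w0: "w \<noteq> 0" using S by (auto simp: w_def)
  have n1: "norm (g k) = 1" using w0 by (simp add: gk)
  have o: "g i \<bullet> g k = 0" if i: "i < k" for i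
  proof -
    have orth: "g i \<bullet> g j = (if i = j then 1 else 0)" if "j < k" for j
    proof (cases i j rule: linorder_cases)
      case less thus ?thesis using IH2[OF that] by simp
    next
      case equal thus ?thesis using IH1[OF that] by (simp add: norm_eq_1)
    next
      case greater thus ?thesis using IH2[OF i, of j] by (simp add: inner_commute)
    qed
    have "g i \<bullet> w = g i \<bullet> c k - (\<Sum>j<k. (g j \<bullet> c k) * (if i = j then 1 else 0))"
      by (simp add: w_def inner_diff_right inner_sum_right orth)
    also have "\<dots> = 0" using i by (simp add: if_distrib sum.delta cong: if_cong)
    finally show ?thesis by (simp add: gk)
  qed
  have "c k \<in> span (c ` {..k})" by (intro span_base) auto
  moreover have "(\<Sum>j<k. (g j \<bullet> c k) *\<^sub>R g j) \<in> span (c ` {..k})"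
  proof -
    have "c ` {..<k} \<subseteq> c ` {..k}" by (intro image_mono) auto
    thus ?thesis using S span_mono by blast
  qed
  ultimately have "w \<in> span (c ` {..k})"
    unfolding w_def by (intro span_diff)
  hence "g k \<in> span (c ` {..k})" by (simp add: gk span_scale)
  thus ?case using n1 o by (simp add: g_def c_def)
qed

lemma is_haar_orthogonal_exists: "\<exists>\<mu> :: (real^'n^'n) measure. is_haar_orthogonal \<mu>"
proof -
  obtain e :: "nat \<Rightarrow> 'n" where e: "bij_betw e {..<CARD('n)} UNIV"
    using ex_bij_betw_nat_finite[of "UNIV :: 'n set"] by (auto simp: atLeast0LessThan)
  define idx where "idx = inv_into {..<CARD('n)} e"
  have idx: "idx i < CARD('n)" "e (idx i) = i" for i
    using e bij_betw_inv_into[OF e] unfolding idx_def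
    by (auto simp: bij_betw_def f_inv_into_f)
  define F :: "real^'n^'n \<Rightarrow> real^'n^'n"
    where "F = (\<lambda>X. \<chi> r s. gram_schmidt_col e X (idx s) $ r)"
  have colF: "column s (F X) = gram_schmidt_col e X (idx s)" for s X
    by (simp add: F_def column_def vec_eq_iff)
  have F_equiv: "F (V ** X) = V ** F X" if "orthogonal_matrix V" for V X
    using that
    unfolding F_def gram_schmidt_col_equivariant[OF that]
    by (simp add: vec_eq_iff matrix_matrix_mult_def matrix_vector_mult_def)
  have F_orth: "orthogonal_matrix (F X)" if X: "det X \<noteq> 0" for X
    unfolding orthogonal_matrix_orthonormal_columns colF
  proof (intro conjI allI impI)
    fix i show "norm (gram_schmidt_col e X (idx i)) = 1"
      using gram_schmidt_col_orthonormal[OF e X idx(1)] by blast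
  next
    fix i j :: 'n assume "i \<noteq> j"
    hence "idx i \<noteq> idx j" using idx(2) by metis
    thus "orthogonal (gram_schmidt_col e X (idx i)) (gram_schmidt_col e X (idx j))"
      using gram_schmidt_col_orthonormal[OF e X idx(1)[of i]]
        gram_schmidt_col_orthonormal[OF e X idx(1)[of j]]
      unfolding orthogonal_def by (metis inner_commute linorder_neqE_nat)
  qed
  have F_meas [measurable]: "F \<in> borel_measurable borel"
  proof -
    have nth: "(\<lambda>v :: real^'n. v $ r) \<in> borel_measurable borel" for r
      by (intro borel_measurable_continuous_onI continuous_intros)
    have [measurable]: "(\<lambda>X. gram_schmidt_col e X k $ r) \<in> borel_measurable borel" for k r
      by (rule measurable_compose[OF gram_schmidt_col_measurable nth])
    show ?thesis
      by (subst borel_measurable_euclidean_space)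
         (auto simp: Basis_vec_def F_def inner_axis)
  qed
  define G where "G = {X :: real^'n^'n. norm X < 1 \<and> det X \<noteq> 0}"
  have cont_det: "continuous_on UNIV (det :: real^'n^'n \<Rightarrow> real)"
    unfolding det_def by (intro continuous_intros)
  have "open G"
  proof -
    have "G = ball 0 1 \<inter> det -` (- {0})" by (auto simp: G_def)
    moreover have "open (det -` (- {0 :: real}) :: (real^'n^'n) set)"
      using cont_det by (intro open_vimage) auto
    ultimately show ?thesis by auto
  qed
  hence G [measurable]: "G \<in> sets borel" by simp
  have "G \<noteq> {}"
  proof -
    define m where "m = norm (mat 1 :: real^'n^'n)"
    define t where "t = 1 / (2 * m)"
    have "mat 1 \<noteq> (0 :: real^'n^'n)"
      using det_I[where ?'n = 'n and ?'a = real] det_0[where ?'n = 'n and ?'a = real] by force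
    hence m: "m > 0" by (simp add: m_def)
    hence t: "t > 0" by (simp add: t_def)
    have "mat t = t *\<^sub>R (mat 1 :: real^'n^'n)"
      by (simp add: vec_eq_iff mat_def)
    hence "norm (mat t :: real^'n^'n) = t * m" using t by (simp add: m_def)
    also have "\<dots> < 1" using m by (simp add: t_def)
    finally have "norm (mat t :: real^'n^'n) < 1" .
    moreover have "det (mat t :: real^'n^'n) \<noteq> 0"
      using t by (subst det_diagonal) (auto simp: mat_def)
    ultimately have "mat t \<in> G" by (simp add: G_def)
    thus ?thesis by auto
  qed
  have G_pos: "emeasure lborel G \<noteq> 0"
    using \<open>open G\<close> \<open>G \<noteq> {}\<close> open_not_negligible[of G]
    by (auto simp: negligible_iff_null_sets null_sets_def)
  have G_fin: "emeasure lborel G \<noteq> \<infinity>"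
  proof -
    have "emeasure lborel G \<le> emeasure lborel (ball (0 :: real^'n^'n) 1)"
      by (intro emeasure_mono) (auto simp: G_def)
    thus ?thesis using emeasure_lborel_ball_finite[of "0 :: real^'n^'n" 1] by (auto simp: top_unique)
  qed
  define P where "P = uniform_measure lborel G"
  define \<mu> where "\<mu> = distr P borel F"
  have [measurable_cong]: "sets P = sets borel" by (simp add: P_def)
  interpret P: prob_space P
    unfolding P_def by (intro prob_space_uniform_measure G_pos G_fin)
  have P_inv: "distr P borel (\<lambda>X. V ** X) = P" if V: "orthogonal_matrix V" for V
  proof (rule measure_eqI)
    have inv: "transpose V ** V = mat 1" "V ** transpose V = mat 1"
      using V by (auto simp: orthogonal_matrix_def)
    have lin: "linear (\<lambda>X :: real^'n^'n. V ** X)"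
      by (auto intro!: linearI simp: matrix_add_ldistrib vec_eq_iff matrix_matrix_mult_def
            sum_distrib_left sum.distrib algebra_simps)
    have nrm: "norm (V ** X) = norm X" for X :: "real^'n^'n"
    proof -
      have *: "(norm Y)\<^sup>2 = (\<Sum>s\<in>UNIV. (norm (column s Y))\<^sup>2)" for Y :: "real^'n^'n"
        unfolding power2_norm_eq_inner inner_vec_def column_def
        by (simp add: inner_vec_def) (rule sum.swap)
      have "column s (V ** X) = V *v column s X" for s
        by (simp add: vec_eq_iff column_def matrix_matrix_mult_def matrix_vector_mult_def)
      moreover have "orthogonal_transformation ((*v) V)"
        using V by (simp add: orthogonal_transformation_matrix)
      ultimately have "(norm (V ** X))\<^sup>2 = (norm X)\<^sup>2"
        by (simp add: * orthogonal_transformation_norm)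
      thus ?thesis by simp
    qed
    have ot: "orthogonal_transformation (\<lambda>X :: real^'n^'n. V ** X)"
      using lin nrm by (simp add: orthogonal_transformation)
    have detV: "det V \<noteq> 0"
      using det_orthogonal_matrix[OF V] by auto
    show "sets (distr P borel (\<lambda>X. V ** X)) = sets P" by (simp add: P_def)
    fix E assume "E \<in> sets (distr P borel (\<lambda>X. V ** X))"
    hence E [measurable]: "E \<in> sets borel" by simp
    have "emeasure (distr P borel (\<lambda>X. V ** X)) E = emeasure P ((\<lambda>X. V ** X) -` E)"
      by (subst emeasure_distr) (auto simp: P_def)
    also have "\<dots> = emeasure lborel (G \<inter> (\<lambda>X. V ** X) -` E) / emeasure lborel G"
      unfolding P_def using measurable_sets[of "\<lambda>X. V ** X" borel borel E]
      by (subst emeasure_uniform_measure) auto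
    also have "G \<inter> (\<lambda>X. V ** X) -` E = (\<lambda>X. V ** X) -` (G \<inter> E) \<inter> space lborel"
      by (auto simp: G_def nrm det_mul detV)
    also have "emeasure lborel \<dots> = emeasure (distr lborel borel (\<lambda>X. V ** X)) (G \<inter> E)"
      by (intro emeasure_distr[symmetric]) auto
    also have "\<dots> = emeasure lborel (G \<inter> E)" by (simp add: lborel_distr_isometry[OF ot])
    also have "\<dots> / emeasure lborel G = emeasure P E"
      unfolding P_def by (subst emeasure_uniform_measure) auto
    finally show "emeasure (distr P borel (\<lambda>X. V ** X)) E = emeasure P E" .
  qed
  have "is_haar_orthogonal \<mu>"
    unfolding is_haar_orthogonal_def
  proof (intro conjI allI impI)
    show "prob_space \<mu>" unfolding \<mu>_def by (rule P.prob_space_distr) measurable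
    show "sets \<mu> = sets borel" by (simp add: \<mu>_def)
    have "AE X in P. X \<in> G" unfolding P_def by (rule AE_uniform_measureI) auto
    hence "AE X in P. orthogonal_matrix (F X)"
      by eventually_elim (auto simp: G_def intro: F_orth)
    thus "AE U in \<mu>. orthogonal_matrix U"
      unfolding \<mu>_def by (subst AE_distr_iff) auto
    fix V :: "real^'n^'n" assume V: "orthogonal_matrix V"
    have "distr \<mu> borel (\<lambda>U. V ** U) = distr P borel (\<lambda>X. V ** F X)"
      unfolding \<mu>_def by (subst distr_distr) (auto simp: o_def)
    also have "\<dots> = distr P borel (\<lambda>X. F (V ** X))"
      by (simp add: F_equiv[OF V])
    also have "\<dots> = distr (distr P borel (\<lambda>X. V ** X)) borel F"
      by (subst distr_distr) (auto simp: o_def)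
    also have "\<dots> = \<mu>" by (simp add: P_inv[OF V] \<mu>_def)
    finally show "distr \<mu> borel (\<lambda>U. V ** U) = \<mu>" .
  qed
  thus ?thesis by blast
qed

lemma is_haar_orthogonal_haar: "is_haar_orthogonal (haar_orthogonal :: (real^'n^'n) measure)"
  unfolding haar_orthogonal_def
  by (rule theI') (use is_haar_orthogonal_exists is_haar_orthogonal_unique in blast)

text \<open>Expectation of a random polynomial of degree at most \<open>d\<close>, taken coefficientwise.\<close>

definition expectation_poly :: "nat \<Rightarrow> 'a measure \<Rightarrow> ('a \<Rightarrow> real poly) \<Rightarrow> real poly" where
  "expectation_poly d M f = (\<Sum>k\<le>d. monom (\<integral>\<omega>. coeff (f \<omega>) k \<partial>M) k)"

text \<open>Independence of \<open>R\<close> and \<open>Q\<close> is expressed by the product measure.\<close>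

definition expected_charpoly :: "real^'n^'n \<Rightarrow> real^'n^'n \<Rightarrow> real poly" where
  "expected_charpoly A B =
     expectation_poly CARD('n) (haar_orthogonal \<Otimes>\<^sub>M haar_orthogonal)
       (\<lambda>(R, Q). charpoly ((A + R ** B ** Q) ** transpose (A + R ** B ** Q)))"

text \<open>The dimension \<open>d\<close> is the cardinality of the index type. The description operator
  is meaningful only if \<open>A\<close> and \<open>B\<close> exist and the result does not depend on their choice.\<close>

definition asym_add_conv :: "'n::finite itself \<Rightarrow> real poly \<Rightarrow> real poly \<Rightarrow> real poly" where
  "asym_add_conv _ p q =
     (THE r. \<exists>A B :: real^'n^'n. charpoly (A ** transpose A) = p \<and>
        charpoly (B ** transpose B) = q \<and> r = expected_charpoly A B)"

end

theory Submission
  imports Defs "HOL-Computational_Algebra.Fundamental_Theorem_Algebra"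
begin

text \<open>By the Cauchy--Binet formula, up to sign the coefficient of \<open>x ^ (d - k)\<close> in the characteristic
  polynomial of \<open>M M\<^sup>T\<close> is the sum of the squares of all \<open>k\<close>-minors of \<open>M\<close>. A minor of \<open>A + C\<close> with
  \<open>C = R B Q\<close> is, by Laplace expansion, a signed sum of products of a minor of \<open>A\<close> and the
  complementary minor of \<open>C\<close>. The law of \<open>C\<close> is invariant under orthogonal matrices on both sides:
  sign flips of rows and columns show that distinct minors of \<open>C\<close> are uncorrelated, and
  permutation matrices show that all \<open>j\<close>-minors of \<open>C\<close> have the same second moment, which is therefore
  \<open>b\<^sub>j\<close> divided by the square of \<open>d choose j\<close>. Squaring, integrating and counting the pairs of
  sets that contain a given pair of \<open>i\<close>-sets gives the formula.\<close>

section \<open>Minors\<close>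

text \<open>The rows are \<open>S\<close> and the columns \<open>\<beta> ` S\<close>, for a bijection \<open>\<beta>\<close> of the index type. The index type
  is not ordered, so the minor for a pair of sets is determined only up to sign; this is
  harmless because only squares of minors matter.\<close>

definition minor :: "'n set \<Rightarrow> ('n \<Rightarrow> 'n) \<Rightarrow> real^'n^'n \<Rightarrow> real" where
  "minor S \<beta> M = (\<Sum>\<pi> | \<pi> permutes S. of_int (sign \<pi>) * (\<Prod>i\<in>S. M $ i $ \<beta> (\<pi> i)))"

text \<open>A bijection of the whole index type, not only of \<open>S\<close>, so that
  \<open>inv\<close> and composition with permutations need no domain conditions. The choice is
  arbitrary when the two sets differ in size.\<close>

definition matching :: "'n set \<Rightarrow> 'n set \<Rightarrow> 'n \<Rightarrow> 'n" where
  "matching S T = (SOME \<beta>. bij \<beta> \<and> \<beta> ` S = T)"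

abbreviation set_minor :: "'n set \<Rightarrow> 'n set \<Rightarrow> real^'n^'n \<Rightarrow> real" where
  "set_minor S T \<equiv> minor S (matching S T)"

text \<open>In a finite type, sets of equal size have complements of equal size, so a bijection of
  the sets and one of the complements glue together.\<close>

lemma matching:
  fixes S T :: "'n::finite set"
  assumes "card S = card T"
  shows "bij (matching S T)" "matching S T ` S = T"
proof -
  obtain f where f: "bij_betw f S T"
    using assms finite_same_card_bij[of S T] by auto
  have "card (- S) = card (- T)"
    using assms by (simp add: Compl_eq_Diff_UNIV card_Diff_subset)
  then obtain g where g: "bij_betw g (- S) (- T)"
    using finite_same_card_bij[of "- S" "- T"] by auto
  define h where "h = (\<lambda>x. if x \<in> S then f x else g x)"
  have "bij_betw h (S \<union> - S) (T \<union> - T)"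
    unfolding h_def by (rule bij_betw_disjoint_Un[OF f g]) auto
  moreover have "h ` S = T"
    using f by (auto simp: h_def bij_betw_def)
  ultimately have "\<exists>\<beta>. bij \<beta> \<and> \<beta> ` S = T" by auto
  hence "bij (matching S T) \<and> matching S T ` S = T"
    unfolding matching_def by (rule someI_ex)
  thus "bij (matching S T)" "matching S T ` S = T" by auto
qed

text \<open>The map \<open>inv \<beta> \<circ> \<gamma>\<close> carries \<open>S\<close> onto
  itself; made the identity outside \<open>S\<close> it is the permutation by which two enumerations
  of the same columns differ.\<close>

lemma bij_factor_permutes:
  assumes "bij \<beta>" "bij \<gamma>" "\<gamma> ` S = \<beta> ` S"
  obtains \<sigma> where "\<sigma> permutes S" "\<And>i. i \<in> S \<Longrightarrow> \<gamma> i = \<beta> (\<sigma> i)"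
proof
  let ?f = "inv \<beta> \<circ> \<gamma>"
  have "bij ?f" using assms by (simp add: bij_comp bij_imp_bij_inv)
  moreover have "?f ` S = S"
    using assms by (simp only: image_comp[symmetric] image_inv_f_f bij_is_inj)
  ultimately have "bij_betw ?f S S"
    by (metis bij_is_inj bij_betw_def inj_on_subset subset_UNIV)
  thus "restrict_id ?f S permutes S" by (rule permutes_restrict_id)
  show "\<gamma> i = \<beta> (restrict_id ?f S i)" if "i \<in> S" for i
    using that assms(1) by (simp add: restrict_id_def surj_f_inv_f bij_is_surj)
qed

lemma sign_compose_permutes:
  fixes \<sigma> \<pi> :: "'n::finite \<Rightarrow> 'n"
  assumes "\<sigma> permutes S" "\<pi> permutes T"
  shows "sign (\<sigma> \<circ> \<pi>) = sign \<sigma> * sign \<pi>"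
  using assms by (intro sign_compose permutes_imp_permutation[of _]) auto

lemma of_int_sign_cases: "(of_int (sign \<sigma>) :: real) \<in> {1, -1}"
  by (cases \<sigma> rule: sign_cases) auto

text \<open>Reordering the columns amounts to substituting \<open>\<sigma> \<circ> \<pi>\<close> for
  \<open>\<pi>\<close> in the Leibniz sum.\<close>

lemma minor_compose_right:
  fixes M :: "real^'n^'n"
  assumes "\<sigma> permutes S" and "\<And>i. i \<in> S \<Longrightarrow> \<gamma> i = \<beta> (\<sigma> i)"
  shows "minor S \<gamma> M = of_int (sign \<sigma>) * minor S \<beta> M"
proof -
  have "minor S \<gamma> M = (\<Sum>\<pi> | \<pi> permutes S. of_int (sign \<pi>) * (\<Prod>i\<in>S. M $ i $ \<beta> ((\<sigma> \<circ> \<pi>) i)))"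
    unfolding minor_def using assms(2)
    by (intro sum.cong arg_cong2[where f = "(*)"] prod.cong) (auto simp: permutes_in_image)
  \<comment> \<open>The sign of \<open>\<sigma>\<close> now occurs twice, and its square is
    1.\<close>
  also have "\<dots> = (\<Sum>\<pi> | \<pi> permutes S. of_int (sign \<sigma>) *
      (of_int (sign (\<sigma> \<circ> \<pi>)) * (\<Prod>i\<in>S. M $ i $ \<beta> ((\<sigma> \<circ> \<pi>) i))))"
    by (intro sum.cong) (auto simp: sign_compose_permutes[OF assms(1)] simp flip: of_int_mult mult.assoc)
  also have "\<dots> = of_int (sign \<sigma>) * minor S \<beta> M"
    unfolding minor_def sum_distrib_left
    by (rule setum_permutations_compose_left[OF assms(1), symmetric])
  finally show ?thesis .
qed

lemma minor_sign_unique: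
  fixes \<beta> \<gamma> :: "'n::finite \<Rightarrow> 'n"
  assumes "bij \<beta>" "bij \<gamma>" "\<gamma> ` S = \<beta> ` S"
  obtains \<epsilon> where "\<epsilon> \<in> {1, -1}" "\<And>M. minor S \<gamma> M = \<epsilon> * minor S \<beta> M"
proof -
  obtain \<sigma> where "\<sigma> permutes S" "\<And>i. i \<in> S \<Longrightarrow> \<gamma> i = \<beta> (\<sigma> i)"
    using bij_factor_permutes[OF assms] by metis
  thus thesis using that[OF of_int_sign_cases] minor_compose_right by metis
qed

lemma minor_power2_eq:
  fixes \<beta> \<gamma> :: "'n::finite \<Rightarrow> 'n"
  assumes "bij \<beta>" "bij \<gamma>" "\<gamma> ` S = \<beta> ` S"
  shows "(minor S \<gamma> M)\<^sup>2 = (minor S \<beta> M)\<^sup>2"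
proof -
  obtain \<epsilon> where "\<epsilon> \<in> {1, -1}" "minor S \<gamma> M = \<epsilon> * minor S \<beta> M"
    using minor_sign_unique[OF assms] by metis
  thus ?thesis by auto
qed

section \<open>Laplace expansion of a minor of a sum\<close>

text \<open>The stabiliser of \<open>U\<close> in the symmetric group of \<open>S\<close> is the
  product of the symmetric groups of \<open>U\<close> and \<open>S - U\<close>. Restriction to the
  two blocks inverts \<open>(\<sigma>, \<tau>) \<mapsto> \<sigma> \<circ> \<tau>\<close>.\<close>

lemma sum_permutes_preserving:
  fixes f :: "('n::finite \<Rightarrow> 'n) \<Rightarrow> 'a::comm_monoid_add"
  assumes "U \<subseteq> S"
  shows "(\<Sum>\<rho> | \<rho> permutes S \<and> \<rho> ` U = U. f \<rho>) =
    (\<Sum>(\<sigma>, \<tau>) \<in> {\<sigma>. \<sigma> permutes U} \<times> {\<tau>. \<tau> permutes (S - U)}. f (\<sigma> \<circ> \<tau>))"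
proof -
  have img: "\<rho> ` (S - U) = S - U" if "\<rho> permutes S" "\<rho> ` U = U" for \<rho>
    using that by (simp add: image_set_diff permutes_inj permutes_image)
  have restr: "restrict_id \<rho> U \<circ> restrict_id \<rho> (S - U) = \<rho>" if r: "\<rho> permutes S" "\<rho> ` U = U" for \<rho>
  proof
    fix i
    consider "i \<in> U" | "i \<in> S - U" | "i \<notin> S" by blast
    thus "(restrict_id \<rho> U \<circ> restrict_id \<rho> (S - U)) i = \<rho> i"
    proof cases
      case 2
      hence "\<rho> i \<in> S - U" using img[OF r] by blast
      thus ?thesis using 2 by (simp add: restrict_id_def)
    next
      case 3
      thus ?thesis using assms r(1) by (auto simp: restrict_id_def permutes_not_in)
    qed (simp add: restrict_id_def)
  qed
  show ?thesis
  proof (rule sum.reindex_bij_witness[where i = "\<lambda>(\<sigma>, \<tau>). \<sigma> \<circ> \<tau>"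
        and j = "\<lambda>\<rho>. (restrict_id \<rho> U, restrict_id \<rho> (S - U))"], goal_cases)
    case (1 \<rho>)
    thus ?case using restr by auto
  next
    case (2 \<rho>)
    hence r: "\<rho> permutes S" "\<rho> ` U = U" by auto
    thus ?case using img[OF r]
      by (auto intro!: permutes_restrict_id simp: bij_betw_def permutes_inj_on)
  next
    case (3 x)
    then obtain \<sigma> \<tau> where x: "x = (\<sigma>, \<tau>)" "\<sigma> permutes U" "\<tau> permutes (S - U)" by auto
    have "restrict_id (\<sigma> \<circ> \<tau>) U = \<sigma>"
      using x by (auto simp: restrict_id_def fun_eq_iff permutes_not_in)
    moreover have "restrict_id (\<sigma> \<circ> \<tau>) (S - U) = \<tau>"
    proof
      fix i
      have "\<tau> i \<in> S - U" if "i \<in> S - U"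
        using that x(3) permutes_in_image by metis
      thus "restrict_id (\<sigma> \<circ> \<tau>) (S - U) i = \<tau> i"
        using x by (auto simp: restrict_id_def permutes_not_in)
    qed
    ultimately show ?case using x by simp
  next
    case (4 x)
    then obtain \<sigma> \<tau> where x: "x = (\<sigma>, \<tau>)" "\<sigma> permutes U" "\<tau> permutes (S - U)" by auto
    have "\<sigma> permutes S" "\<tau> permutes S" using x assms permutes_subset by blast+
    hence "\<sigma> \<circ> \<tau> permutes S" by (simp add: permutes_compose)
    moreover have "\<tau> ` U = U"
      using permutes_not_in[OF x(3)] by (auto simp: image_iff)
    hence "(\<sigma> \<circ> \<tau>) ` U = U" using x(2) by (simp only: image_comp[symmetric] permutes_image)
    ultimately show ?case using x by simp
  next
    case (5 \<rho>)
    thus ?case using restr by auto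
  qed
qed

text \<open>The permutations that send the rows \<open>U\<close> to the columns \<open>V\<close>
  form a coset of the stabiliser of \<open>U\<close>. Relative to a representative
  \<open>\<pi>0\<close> that follows the two chosen matchings, the sum factors into the two minors,
  and \<open>\<epsilon>\<close> is the sign of \<open>\<pi>0\<close>. The sign is fixed before
  \<open>A\<close> and \<open>C\<close>, so it stays constant when \<open>C\<close> becomes
  random.\<close>

lemma laplace_term:
  fixes \<beta> :: "'n::finite \<Rightarrow> 'n"
  assumes \<beta>: "bij \<beta>" and US: "U \<subseteq> S" and V: "V \<subseteq> \<beta> ` S" and UV: "card U = card V"
  obtains \<epsilon> where "\<epsilon> \<in> {1, -1}"
    "\<And>A C :: real^'n^'n.
      (\<Sum>\<pi> | \<pi> permutes S \<and> \<beta> ` \<pi> ` U = V. of_int (sign \<pi>) *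
          ((\<Prod>i\<in>U. A $ i $ \<beta> (\<pi> i)) * (\<Prod>i\<in>S-U. C $ i $ \<beta> (\<pi> i)))) =
      \<epsilon> * set_minor U V A * set_minor (S - U) (\<beta> ` S - V) C"
proof -
  define T where "T = \<beta> ` S"
  have "card S = card T"
    by (simp add: T_def card_image inj_on_subset[OF bij_is_inj[OF \<beta>]])
  hence c: "card (S - U) = card (T - V)"
    using US V UV by (simp add: card_Diff_subset T_def)
  define \<beta>1 where "\<beta>1 = matching U V"
  define \<beta>2 where "\<beta>2 = matching (S - U) (T - V)"
  note m1 = matching[OF UV, folded \<beta>1_def] and m2 = matching[OF c, folded \<beta>2_def]
  \<comment> \<open>On \<open>S\<close> this is the permutation that \<open>\<beta>\<close> turns
    into \<open>\<beta>1\<close> on \<open>U\<close> and \<open>\<beta>2\<close> on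
    \<open>S - U\<close>.\<close>
  define \<phi> where "\<phi> = (\<lambda>i. inv \<beta> (if i \<in> U then \<beta>1 i else \<beta>2 i))"
  have b\<phi>: "\<beta> (\<phi> i) = (if i \<in> U then \<beta>1 i else \<beta>2 i)" for i
    using \<beta> by (simp add: \<phi>_def surj_f_inv_f bij_is_surj)
  have "bij_betw (\<lambda>i. if i \<in> U then \<beta>1 i else \<beta>2 i) (U \<union> (S - U)) (V \<union> (T - V))"
    using m1(2) m2(2) inj_on_subset[OF bij_is_inj[OF m1(1)]] inj_on_subset[OF bij_is_inj[OF m2(1)]]
    by (intro bij_betw_disjoint_Un) (auto simp: bij_betw_def)
  moreover have "bij_betw (inv \<beta>) (V \<union> (T - V)) S"
    using V inj_on_subset[OF bij_is_inj[OF bij_imp_bij_inv[OF \<beta>]] subset_UNIV]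
      image_inv_f_f[OF bij_is_inj[OF \<beta>]]
    by (simp add: bij_betw_def T_def Un_absorb1)
  ultimately have "bij_betw (inv \<beta> \<circ> (\<lambda>i. if i \<in> U then \<beta>1 i else \<beta>2 i)) (U \<union> (S - U)) S"
    by (rule bij_betw_trans)
  hence "bij_betw \<phi> S S" using US by (simp add: \<phi>_def o_def Un_absorb1)
  define \<pi>0 where "\<pi>0 = restrict_id \<phi> S"
  have p0: "\<pi>0 permutes S" unfolding \<pi>0_def by (rule permutes_restrict_id) fact
  have bp0: "\<beta> (\<pi>0 i) = (if i \<in> U then \<beta>1 i else \<beta>2 i)" if "i \<in> S" for i
    using that by (simp add: \<pi>0_def restrict_id_def b\<phi>)
  have bp0U: "\<beta> ` \<pi>0 ` U = V"
  proof -
    have "\<beta> ` \<pi>0 ` U = \<beta>1 ` U"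
      unfolding image_image using US by (intro image_cong) (auto simp: bp0)
    thus ?thesis using m1 by simp
  qed
  have "(\<Sum>\<pi> | \<pi> permutes S \<and> \<beta> ` \<pi> ` U = V. of_int (sign \<pi>) *
          ((\<Prod>i\<in>U. A $ i $ \<beta> (\<pi> i)) * (\<Prod>i\<in>S-U. C $ i $ \<beta> (\<pi> i)))) =
      of_int (sign \<pi>0) * set_minor U V A * set_minor (S - U) (\<beta> ` S - V) C"
    (is "sum ?g _ = _") for A C :: "real^'n^'n"
  proof -
    \<comment> \<open>Translating the coset by \<open>inv \<pi>0\<close> gives the stabiliser of
      \<open>U\<close>, since \<open>\<beta>\<close> is injective.\<close>
    have "sum ?g {\<pi>. \<pi> permutes S \<and> \<beta> ` \<pi> ` U = V} =
        (\<Sum>\<rho> | \<rho> permutes S \<and> \<rho> ` U = U. ?g (\<pi>0 \<circ> \<rho>))"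
    proof (rule sum.reindex_bij_witness[where i = "\<lambda>\<rho>. \<pi>0 \<circ> \<rho>" and j = "\<lambda>\<pi>. inv \<pi>0 \<circ> \<pi>"], goal_cases)
      case (1 \<pi>) thus ?case using p0 by (simp add: o_assoc permutes_inv_o)
    next
      case (2 \<pi>)
      hence "\<beta> ` \<pi> ` U = \<beta> ` \<pi>0 ` U" using bp0U by simp
      hence "\<pi> ` U = \<pi>0 ` U" using \<beta> by (simp add: inj_image_eq_iff bij_is_inj)
      hence "(inv \<pi>0 \<circ> \<pi>) ` U = U"
        by (simp only: image_comp[symmetric] image_inv_f_f[OF permutes_inj[OF p0]])
      thus ?case using 2 p0 by (simp add: permutes_compose permutes_inv)
    next
      case (3 \<rho>) thus ?case using p0 by (simp add: o_assoc permutes_inv_o)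
    next
      case (4 \<rho>) thus ?case using p0 bp0U
        by (auto simp only: permutes_compose image_comp[symmetric] mem_Collect_eq)
    next
      case (5 \<pi>) thus ?case using p0 by (simp add: o_assoc permutes_inv_o)
    qed
    also have "\<dots> = (\<Sum>(\<sigma>, \<tau>) \<in> {\<sigma>. \<sigma> permutes U} \<times> {\<tau>. \<tau> permutes (S - U)}. ?g (\<pi>0 \<circ> (\<sigma> \<circ> \<tau>)))"
      by (rule sum_permutes_preserving[OF US])
    also have "\<dots> = (\<Sum>(\<sigma>, \<tau>) \<in> {\<sigma>. \<sigma> permutes U} \<times> {\<tau>. \<tau> permutes (S - U)}.
        of_int (sign \<pi>0) * ((of_int (sign \<sigma>) * (\<Prod>i\<in>U. A $ i $ \<beta>1 (\<sigma> i))) *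
          (of_int (sign \<tau>) * (\<Prod>i\<in>S-U. C $ i $ \<beta>2 (\<tau> i)))))"
    proof (intro sum.cong refl, clarify)
      fix \<sigma> \<tau> assume s: "\<sigma> permutes U" and t: "\<tau> permutes (S - U)"
      have "sign (\<pi>0 \<circ> (\<sigma> \<circ> \<tau>)) = sign \<pi>0 * (sign \<sigma> * sign \<tau>)"
        using sign_compose_permutes[OF s t] p0 s t US
        by (metis Diff_subset permutes_compose permutes_subset sign_compose_permutes)
      moreover have "(\<Prod>i\<in>U. A $ i $ \<beta> ((\<pi>0 \<circ> (\<sigma> \<circ> \<tau>)) i)) = (\<Prod>i\<in>U. A $ i $ \<beta>1 (\<sigma> i))"
      proof (rule prod.cong[OF refl])
        fix i assume i: "i \<in> U"
        hence "\<tau> i = i" using permutes_not_in[OF t] by auto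
        moreover have "\<sigma> i \<in> U" using i s by (simp add: permutes_in_image)
        ultimately show "A $ i $ \<beta> ((\<pi>0 \<circ> (\<sigma> \<circ> \<tau>)) i) = A $ i $ \<beta>1 (\<sigma> i)"
          using US by (auto simp: bp0)
      qed
      moreover have "(\<Prod>i\<in>S-U. C $ i $ \<beta> ((\<pi>0 \<circ> (\<sigma> \<circ> \<tau>)) i)) = (\<Prod>i\<in>S-U. C $ i $ \<beta>2 (\<tau> i))"
      proof (rule prod.cong[OF refl])
        fix i assume i: "i \<in> S - U"
        hence ti: "\<tau> i \<in> S - U" using t by (simp only: permutes_in_image)
        hence "\<sigma> (\<tau> i) = \<tau> i" using permutes_not_in[OF s] by auto
        thus "C $ i $ \<beta> ((\<pi>0 \<circ> (\<sigma> \<circ> \<tau>)) i) = C $ i $ \<beta>2 (\<tau> i)"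
          using ti by (simp add: bp0)
      qed
      ultimately show "?g (\<pi>0 \<circ> (\<sigma> \<circ> \<tau>)) =
         of_int (sign \<pi>0) * ((of_int (sign \<sigma>) * (\<Prod>i\<in>U. A $ i $ \<beta>1 (\<sigma> i))) *
          (of_int (sign \<tau>) * (\<Prod>i\<in>S-U. C $ i $ \<beta>2 (\<tau> i))))"
        by (simp add: mult_ac)
    qed
    also have "\<dots> = of_int (sign \<pi>0) * (minor U \<beta>1 A * minor (S - U) \<beta>2 C)"
      unfolding minor_def sum_product sum.cartesian_product
      by (simp add: case_prod_unfold sum_distrib_left)
    finally show ?thesis by (simp add: \<beta>1_def \<beta>2_def T_def mult.assoc)
  qed
  thus thesis using that[OF of_int_sign_cases] by blast
qed

text \<open>Multiplying out the product over the rows selects the set \<open>U\<close> of rows taken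
  from \<open>A\<close>. Sorting the permutations by the columns \<open>V\<close> that they assign
  to \<open>U\<close> leaves the sums of \<open>laplace_term\<close>.\<close>

lemma minor_add_laplace:
  fixes \<beta> :: "'n::finite \<Rightarrow> 'n"
  assumes \<beta>: "bij \<beta>"
  obtains \<epsilon> where "\<And>U V. \<epsilon> U V \<in> {1, -1}"
    "\<And>A C :: real^'n^'n. minor S \<beta> (A + C) =
      (\<Sum>(U, V) | U \<subseteq> S \<and> V \<subseteq> \<beta> ` S \<and> card U = card V.
        \<epsilon> U V * set_minor U V A * set_minor (S - U) (\<beta> ` S - V) C)"
proof -
  let ?P = "\<lambda>U V. U \<subseteq> S \<and> V \<subseteq> \<beta> ` S \<and> card U = card V"
  let ?g = "\<lambda>A C U \<pi>. of_int (sign \<pi>) *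
          ((\<Prod>i\<in>U. A $ i $ \<beta> (\<pi> i)) * (\<Prod>i\<in>S-U. C $ i $ \<beta> (\<pi> i)))"
  \<comment> \<open>The condition of being a sign is imposed for all \<open>U\<close> and
    \<open>V\<close>, including pairs outside \<open>?P\<close>, so that the chosen function takes
    only the values 1 and -1.\<close>
  let ?Q = "\<lambda>U V \<epsilon>. \<epsilon> \<in> {1, -1} \<and> (?P U V \<longrightarrow> (\<forall>A C :: real^'n^'n.
      (\<Sum>\<pi> | \<pi> permutes S \<and> \<beta> ` \<pi> ` U = V. ?g A C U \<pi>) =
      \<epsilon> * set_minor U V A * set_minor (S - U) (\<beta> ` S - V) C))"
  have ex: "\<exists>\<epsilon>. ?Q U V \<epsilon>" for U V
  proof (cases "?P U V")
    case True
    show ?thesis by (rule laplace_term[of \<beta> U S V]) (use True \<beta> in auto)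
  qed auto
  define \<epsilon> where "\<epsilon> U V = (SOME \<epsilon>. ?Q U V \<epsilon>)" for U V
  have \<epsilon>: "?Q U V (\<epsilon> U V)" for U V
    unfolding \<epsilon>_def using ex by (rule someI_ex)
  have "minor S \<beta> (A + C) = (\<Sum>(U, V) | ?P U V.
        \<epsilon> U V * set_minor U V A * set_minor (S - U) (\<beta> ` S - V) C)" for A C
  proof -
    have "minor S \<beta> (A + C) = (\<Sum>\<pi> | \<pi> permutes S. \<Sum>U\<in>Pow S. ?g A C U \<pi>)"
      by (simp add: minor_def prod_add sum_distrib_left)
    also have "\<dots> = (\<Sum>U\<in>Pow S. \<Sum>\<pi> | \<pi> permutes S. ?g A C U \<pi>)"
      by (rule sum.swap)
    also have "\<dots> = (\<Sum>U\<in>Pow S. \<Sum>V | V \<subseteq> \<beta> ` S \<and> card U = card V.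
        \<Sum>\<pi> | \<pi> permutes S \<and> \<beta> ` \<pi> ` U = V. ?g A C U \<pi>)"
    proof (rule sum.cong[OF refl])
      fix U assume U: "U \<in> Pow S"
      have "\<beta> ` \<pi> ` U \<subseteq> \<beta> ` S \<and> card U = card (\<beta> ` \<pi> ` U)" if "\<pi> permutes S" for \<pi>
        using that U \<beta> by (auto simp: permutes_in_image card_image bij_is_inj permutes_inj
            inj_on_subset[OF bij_is_inj[OF \<beta>]] inj_on_subset[OF permutes_inj])
      hence "(\<lambda>\<pi>. \<beta> ` \<pi> ` U) ` {\<pi>. \<pi> permutes S} \<subseteq> {V. V \<subseteq> \<beta> ` S \<and> card U = card V}"
        by blast
      from sum.group[OF _ _ this, of "?g A C U"]
      show "(\<Sum>\<pi> | \<pi> permutes S. ?g A C U \<pi>) = (\<Sum>V | V \<subseteq> \<beta> ` S \<and> card U = card V.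
        \<Sum>\<pi> | \<pi> permutes S \<and> \<beta> ` \<pi> ` U = V. ?g A C U \<pi>)"
        by simp
    qed
    also have "\<dots> = (\<Sum>U\<in>Pow S. \<Sum>V | V \<subseteq> \<beta> ` S \<and> card U = card V.
        \<epsilon> U V * set_minor U V A * set_minor (S - U) (\<beta> ` S - V) C)"
      using \<epsilon> by (intro sum.cong refl) auto
    also have "\<dots> = (\<Sum>(U, V) \<in> (SIGMA U:Pow S. {V. V \<subseteq> \<beta> ` S \<and> card U = card V}).
        \<epsilon> U V * set_minor U V A * set_minor (S - U) (\<beta> ` S - V) C)"
      by (subst sum.Sigma) auto
    also have "(SIGMA U:Pow S. {V. V \<subseteq> \<beta> ` S \<and> card U = card V}) = {(U, V). ?P U V}"
      by auto
    finally show ?thesis .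
  qed
  thus thesis using that[of \<epsilon>] \<epsilon> by blast
qed

section \<open>The Cauchy--Binet formula for Gram matrices\<close>

lemma prod_permute_inv:
  assumes "\<pi> permutes S"
  shows "(\<Prod>i\<in>S. f (\<pi> i) i) = (\<Prod>i\<in>S. f i (inv \<pi> i))"
  using prod.permute[OF permutes_inv[OF assms], of "\<lambda>i. f (\<pi> i) i"]
  by (simp add: o_def permutes_inverses[OF assms])

text \<open>Here \<open>\<pi>\<close> acts on the rows; passing to \<open>inv \<pi>\<close> moves it
  to the columns without changing its sign. Such sums arise as the second factor in the
  Cauchy--Binet expansion, with \<open>f\<close> selecting the columns.\<close>

lemma minor_transpose_selection:
  fixes M :: "real^'n^'n"
  assumes "\<sigma> permutes S" "\<And>i. i \<in> S \<Longrightarrow> f i = \<beta> (\<sigma> i)"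
  shows "(\<Sum>\<pi> | \<pi> permutes S. of_int (sign \<pi>) * (\<Prod>i\<in>S. M $ \<pi> i $ f i)) =
    of_int (sign \<sigma>) * minor S \<beta> M"
proof -
  have "(\<Sum>\<pi> | \<pi> permutes S. of_int (sign \<pi>) * (\<Prod>i\<in>S. M $ \<pi> i $ f i)) =
    (\<Sum>\<pi> | \<pi> permutes S. of_int (sign (inv \<pi>)) * (\<Prod>i\<in>S. M $ i $ f (inv \<pi> i)))"
    by (intro sum.cong refl arg_cong2[where f = "(*)"])
      (auto simp: prod_permute_inv[where f = "\<lambda>a b. M $ a $ f b"] sign_inverse permutes_imp_permutation[of S])
  also have "\<dots> = minor S f M"
    unfolding minor_def by (rule sum_permutations_inverse[symmetric])
  also have "\<dots> = of_int (sign \<sigma>) * minor S \<beta> M"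
    by (rule minor_compose_right) fact+
  finally show ?thesis .
qed

text \<open>A determinant with a repeated column vanishes: composing with the transposition of two
  positions at which \<open>f\<close> agrees turns the sum into its negative.\<close>

lemma not_inj_selection_zero:
  fixes M :: "real^'n^'n"
  assumes "\<not> inj_on f S"
  shows "(\<Sum>\<pi> | \<pi> permutes S. of_int (sign \<pi>) * (\<Prod>i\<in>S. M $ \<pi> i $ f i)) = 0"
    (is "sum ?g _ = 0")
proof -
  obtain k l where kl: "k \<in> S" "l \<in> S" "k \<noteq> l" "f k = f l"
    using assms by (auto simp: inj_on_def)
  define q where "q = Transposition.transpose k l"
  have q: "q permutes S" unfolding q_def using kl by (simp add: permutes_swap_id)
  have fq: "f (q i) = f i" for i
    using kl by (auto simp: q_def Transposition.transpose_def)
  have "sum ?g {\<pi>. \<pi> permutes S} = (\<Sum>\<pi> | \<pi> permutes S. ?g (\<pi> \<circ> q))"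
    by (rule sum_permutations_compose_right[OF q])
  also have "\<dots> = (\<Sum>\<pi> | \<pi> permutes S. - ?g \<pi>)"
  proof (rule sum.cong[OF refl])
    fix \<pi> assume "\<pi> \<in> {\<pi>. \<pi> permutes S}"
    hence "sign (\<pi> \<circ> q) = - sign \<pi>"
      using q kl by (simp add: sign_compose_permutes q_def sign_swap_id)
    moreover have "(\<Prod>i\<in>S. M $ (\<pi> \<circ> q) i $ f i) = (\<Prod>i\<in>S. M $ \<pi> i $ f i)"
      using prod.permute[OF q, of "\<lambda>i. M $ \<pi> i $ f i"] by (simp add: o_def fq)
    ultimately show "?g (\<pi> \<circ> q) = - ?g \<pi>" by simp
  qed
  finally show ?thesis by (simp add: sum_negf)
qed

text \<open>Every selection with image \<open>T\<close> is \<open>\<beta>\<close> after a unique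
  permutation of \<open>S\<close>. Extensional functions are used so that a selection is determined
  by its values on \<open>S\<close>.\<close>

lemma sum_over_bijections:
  fixes h :: "('n::finite \<Rightarrow> 'n) \<Rightarrow> real"
  assumes \<beta>: "bij \<beta>" and T: "\<beta> ` S = T"
  shows "(\<Sum>f | f \<in> S \<rightarrow>\<^sub>E UNIV \<and> inj_on f S \<and> f ` S = T. h f) =
    (\<Sum>\<sigma> | \<sigma> permutes S. h (restrict (\<beta> \<circ> \<sigma>) S))"
proof -
  have ext: "restrict (\<beta> \<circ> restrict_id (inv \<beta> \<circ> f) S) S = f" if f: "f \<in> S \<rightarrow>\<^sub>E UNIV" for f
  proof
    fix i
    show "restrict (\<beta> \<circ> restrict_id (inv \<beta> \<circ> f) S) S i = f i"
      using PiE_arb[OF f] surj_f_inv_f[OF bij_is_surj[OF \<beta>]]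
      by (cases "i \<in> S") (simp_all add: restrict_id_def)
  qed
  show ?thesis
  proof (rule sum.reindex_bij_witness[where i = "\<lambda>\<sigma>. restrict (\<beta> \<circ> \<sigma>) S"
        and j = "\<lambda>f. restrict_id (inv \<beta> \<circ> f) S"], goal_cases)
    case (1 f)
    thus ?case using ext by blast
  next
    case (2 f)
    hence "inj_on (inv \<beta> \<circ> f) S"
      using inj_on_subset[OF bij_is_inj[OF bij_imp_bij_inv[OF \<beta>]] subset_UNIV]
      by (simp only: mem_Collect_eq comp_inj_on)
    moreover have "(inv \<beta> \<circ> f) ` S = S"
      using 2 T image_inv_f_f[OF bij_is_inj[OF \<beta>]] by (auto simp only: image_comp[symmetric] mem_Collect_eq)
    ultimately have "bij_betw (inv \<beta> \<circ> f) S S" by (simp add: bij_betw_def)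
    thus ?case by (simp only: mem_Collect_eq permutes_restrict_id)
  next
    case (3 \<sigma>)
    hence s: "\<sigma> permutes S" by simp
    show ?case
    proof
      fix i
      show "restrict_id (inv \<beta> \<circ> restrict (\<beta> \<circ> \<sigma>) S) S i = \<sigma> i"
        using permutes_not_in[OF s] inv_f_f[OF bij_is_inj[OF \<beta>]] by (cases "i \<in> S") (simp_all add: restrict_id_def)
    qed
  next
    case (4 \<sigma>)
    hence s: "\<sigma> permutes S" by simp
    have "inj_on (\<beta> \<circ> \<sigma>) S"
      using permutes_inj_on[OF s] inj_on_subset[OF bij_is_inj[OF \<beta>] subset_UNIV]
      by (simp only: comp_inj_on)
    moreover have "(\<beta> \<circ> \<sigma>) ` S = T"
      using s T by (simp only: image_comp[symmetric] permutes_image)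
    ultimately show ?case by auto
  next
    case (5 f)
    hence "restrict (\<beta> \<circ> restrict_id (inv \<beta> \<circ> f) S) S = f" using ext by blast
    thus ?case by simp
  qed
qed

text \<open>Each entry of the Gram matrix is a sum over columns, so the Leibniz product becomes a
  sum over selections \<open>f\<close> of a column for each row. Only injective selections survive;
  those with image \<open>T\<close> contribute the square of one minor.\<close>

lemma principal_minor_gram:
  fixes M :: "real^'n^'n"
  shows "minor S id (M ** transpose M) = (\<Sum>T | card T = card S. (set_minor S T M)\<^sup>2)"
proof -
  let ?F = "S \<rightarrow>\<^sub>E (UNIV :: 'n set)"
  define P where "P f = (\<Prod>i\<in>S. M $ i $ f i)" for f :: "'n \<Rightarrow> 'n"
  \<comment> \<open>Up to transposition, the determinant formed by the rows \<open>S\<close> and the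
    columns selected by \<open>f\<close>.\<close>
  define G where "G f = (\<Sum>\<pi> | \<pi> permutes S. of_int (sign \<pi>) * (\<Prod>i\<in>S. M $ \<pi> i $ f i))" for f
  have fin: "finite ?F" by (intro finite_PiE) auto
  have "minor S id (M ** transpose M) =
      (\<Sum>\<pi> | \<pi> permutes S. \<Sum>f\<in>?F. P f * (of_int (sign \<pi>) * (\<Prod>i\<in>S. M $ \<pi> i $ f i)))"
    unfolding minor_def
  proof (rule sum.cong[OF refl])
    fix \<pi> assume "\<pi> \<in> {\<pi>. \<pi> permutes S}"
    have "(\<Prod>i\<in>S. (M ** transpose M) $ i $ id (\<pi> i)) = (\<Prod>i\<in>S. \<Sum>j\<in>UNIV. M $ i $ j * M $ \<pi> i $ j)"
      by (simp add: matrix_matrix_mult_def transpose_def)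
    also have "\<dots> = (\<Sum>f\<in>?F. \<Prod>i\<in>S. M $ i $ f i * M $ \<pi> i $ f i)"
      by (rule prod_sum_PiE) auto
    finally show "of_int (sign \<pi>) * (\<Prod>i\<in>S. (M ** transpose M) $ i $ id (\<pi> i)) =
       (\<Sum>f\<in>?F. P f * (of_int (sign \<pi>) * (\<Prod>i\<in>S. M $ \<pi> i $ f i)))"
      by (simp add: sum_distrib_left P_def prod.distrib mult_ac)
  qed
  also have "\<dots> = (\<Sum>f\<in>?F. P f * G f)"
    unfolding G_def sum_distrib_left by (rule sum.swap)
  also have "\<dots> = (\<Sum>f | f \<in> ?F \<and> inj_on f S. P f * G f)"
    using fin by (intro sum.mono_neutral_right) (auto simp: G_def not_inj_selection_zero)
  \<comment> \<open>An injective selection has an image of the size of \<open>S\<close>, by which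
    the terms are grouped.\<close>
  also have "\<dots> = (\<Sum>T | card T = card S. \<Sum>f | f \<in> {f. f \<in> ?F \<and> inj_on f S} \<and> f ` S = T. P f * G f)"
    using fin by (intro sum.group[symmetric]) (auto simp: card_image)
  also have "\<dots> = (\<Sum>T | card T = card S. (set_minor S T M)\<^sup>2)"
  proof (rule sum.cong[OF refl])
    fix T :: "'n set" assume "T \<in> {T. card T = card S}"
    hence c: "card S = card T" by simp
    let ?\<beta> = "matching S T"
    have "(\<Sum>f | f \<in> {f. f \<in> ?F \<and> inj_on f S} \<and> f ` S = T. P f * G f) =
        (\<Sum>\<sigma> | \<sigma> permutes S. P (restrict (?\<beta> \<circ> \<sigma>) S) * G (restrict (?\<beta> \<circ> \<sigma>) S))"
      using sum_over_bijections[OF matching[OF c]] by (simp add: conj_assoc)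
    also have "\<dots> = (\<Sum>\<sigma> | \<sigma> permutes S. of_int (sign \<sigma>) * (\<Prod>i\<in>S. M $ i $ ?\<beta> (\<sigma> i)) * set_minor S T M)"
    proof (rule sum.cong[OF refl])
      fix \<sigma> assume "\<sigma> \<in> {\<sigma>. \<sigma> permutes S}"
      \<comment> \<open>The sign released by \<open>G\<close> is the one that the products
        \<open>P\<close> need to add up to a second copy of the minor.\<close>
      hence "G (restrict (?\<beta> \<circ> \<sigma>) S) = of_int (sign \<sigma>) * set_minor S T M"
        unfolding G_def by (intro minor_transpose_selection) auto
      moreover have "P (restrict (?\<beta> \<circ> \<sigma>) S) = (\<Prod>i\<in>S. M $ i $ ?\<beta> (\<sigma> i))"
        unfolding P_def by (intro prod.cong) auto
      ultimately show "P (restrict (?\<beta> \<circ> \<sigma>) S) * G (restrict (?\<beta> \<circ> \<sigma>) S) =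
        of_int (sign \<sigma>) * (\<Prod>i\<in>S. M $ i $ ?\<beta> (\<sigma> i)) * set_minor S T M" by simp
    qed
    also have "\<dots> = (set_minor S T M)\<^sup>2"
      by (simp add: minor_def power2_eq_square sum_distrib_right)
    finally show "(\<Sum>f | f \<in> {f. f \<in> ?F \<and> inj_on f S} \<and> f ` S = T. P f * G f) = (set_minor S T M)\<^sup>2" .
  qed
  finally show ?thesis .
qed

section \<open>Coefficients of the characteristic polynomial\<close>

lemma poly_charpoly: "poly (charpoly N) x = det (mat x - N)"
  unfolding charpoly_def det_def
  by (simp add: poly_sum poly_prod map_matrix_def mat_def if_distrib[where f = "\<lambda>p. poly p x"] cong: if_cong)

text \<open>Expanding the product of the differences of entries of \<open>xI\<close> and
  \<open>N\<close> chooses the set \<open>S\<close> of rows taken from \<open>N\<close>. Since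
  \<open>xI\<close> is diagonal, only permutations that fix every point outside \<open>S\<close>
  contribute.\<close>

lemma charpoly_eq_sum_principal_minors:
  fixes N :: "real^'n^'n"
  shows "charpoly N = (\<Sum>S\<in>UNIV. monom ((-1) ^ card S * minor S id N) (CARD('n) - card S))"
proof (rule poly_eq_poly_eq_iff[THEN iffD1], rule ext)
  fix x :: real
  have diag: "(\<Prod>i\<in>-S. (if i = \<pi> i then x else 0)) = (if \<pi> permutes S then x ^ (CARD('n) - card S) else 0)"
    if \<pi>: "\<pi> permutes UNIV" for \<pi> :: "'n \<Rightarrow> 'n" and S
  proof (cases "\<pi> permutes S")
    case True
    hence "(\<Prod>i\<in>-S. (if i = \<pi> i then x else 0)) = (\<Prod>i\<in>-S. x)"
      by (intro prod.cong) (auto simp: permutes_not_in)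
    thus ?thesis using True by (simp add: Compl_eq_Diff_UNIV card_Diff_subset)
  next
    case False
    then obtain i where "i \<notin> S" "\<pi> i \<noteq> i"
      using permutes_superset[OF \<pi>, of S] by blast
    hence "(\<Prod>i\<in>-S. (if i = \<pi> i then x else 0)) = 0"
      by (intro prod_zero bexI[of _ i]) auto
    thus ?thesis using False by simp
  qed
  have "poly (charpoly N) x = (\<Sum>\<pi> | \<pi> permutes (UNIV :: 'n set). of_int (sign \<pi>) *
      (\<Prod>i\<in>UNIV. (if i = \<pi> i then x else 0) - N $ i $ \<pi> i))"
    by (simp add: poly_charpoly det_def mat_def)
  also have "\<dots> = (\<Sum>\<pi> | \<pi> permutes (UNIV :: 'n set). \<Sum>S\<in>UNIV. of_int (sign \<pi>) *
      ((-1) ^ card S * (\<Prod>i\<in>S. N $ i $ \<pi> i) * (\<Prod>i\<in>-S. (if i = \<pi> i then x else 0))))"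
    by (simp add: prod_diff_conv_sum sum_distrib_left Compl_eq_Diff_UNIV)
  also have "\<dots> = (\<Sum>S\<in>UNIV. \<Sum>\<pi> | \<pi> permutes (UNIV :: 'n set). of_int (sign \<pi>) *
      ((-1) ^ card S * (\<Prod>i\<in>S. N $ i $ \<pi> i) * (\<Prod>i\<in>-S. (if i = \<pi> i then x else 0))))"
    by (rule sum.swap)
  also have "\<dots> = (\<Sum>S\<in>UNIV. (-1) ^ card S * minor S id N * x ^ (CARD('n) - card S))"
  proof (rule sum.cong[OF refl])
    fix S :: "'n set"
    have "(\<Sum>\<pi> | \<pi> permutes (UNIV :: 'n set). of_int (sign \<pi>) *
      ((-1) ^ card S * (\<Prod>i\<in>S. N $ i $ \<pi> i) * (\<Prod>i\<in>-S. (if i = \<pi> i then x else 0)))) =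
      (\<Sum>\<pi> | \<pi> permutes S. of_int (sign \<pi>) *
      ((-1) ^ card S * (\<Prod>i\<in>S. N $ i $ \<pi> i) * x ^ (CARD('n) - card S)))"
      by (intro sum.mono_neutral_cong_right) (auto simp: diag permutes_subset finite_permutations intro: permutes_subset)
    thus "(\<Sum>\<pi> | \<pi> permutes (UNIV :: 'n set). of_int (sign \<pi>) *
      ((-1) ^ card S * (\<Prod>i\<in>S. N $ i $ \<pi> i) * (\<Prod>i\<in>-S. (if i = \<pi> i then x else 0)))) =
      (-1) ^ card S * minor S id N * x ^ (CARD('n) - card S)"
      by (simp add: minor_def sum_distrib_left sum_distrib_right mult_ac)
  qed
  finally show "poly (charpoly N) x =
      poly (\<Sum>S\<in>UNIV. monom ((-1) ^ card S * minor S id N) (CARD('n) - card S)) x"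
    by (simp add: poly_sum poly_monom)
qed

text \<open>This is the \<open>k\<close>-th elementary symmetric function of the squared singular
  values of \<open>M\<close>.\<close>

definition sum_sq_minors :: "nat \<Rightarrow> real^'n^'n \<Rightarrow> real" where
  "sum_sq_minors k M = (\<Sum>(S, T) | card S = k \<and> card T = k. (set_minor S T M)\<^sup>2)"

text \<open>The principal minors of the Gram matrix are collected by size and expanded by
  Cauchy--Binet.\<close>

lemma charpoly_gram:
  fixes M :: "real^'n^'n"
  shows "charpoly (M ** transpose M) =
    (\<Sum>k\<le>CARD('n). monom ((-1) ^ k * sum_sq_minors k M) (CARD('n) - k))"
proof -
  let ?f = "\<lambda>S. monom ((-1) ^ card S * minor S id (M ** transpose M)) (CARD('n) - card S)"
  have "charpoly (M ** transpose M) = (\<Sum>S\<in>UNIV. ?f S)"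
    by (rule charpoly_eq_sum_principal_minors)
  also have "\<dots> = (\<Sum>k\<le>CARD('n). \<Sum>S | S \<in> UNIV \<and> card S = k. ?f S)"
    by (intro sum.group[symmetric]) (auto intro: card_mono)
  also have "\<dots> = (\<Sum>k\<le>CARD('n). monom ((-1) ^ k * sum_sq_minors k M) (CARD('n) - k))"
  proof (rule sum.cong[OF refl])
    fix k
    have "sum_sq_minors k M = (\<Sum>(S, T) \<in> (SIGMA S:{S. card S = k}. {T. card T = k}). (set_minor S T M)\<^sup>2)"
      unfolding sum_sq_minors_def by (intro sum.cong) auto
    also have "\<dots> = (\<Sum>S | card S = k. \<Sum>T | card T = k. (set_minor S T M)\<^sup>2)"
      by (subst sum.Sigma) auto
    also have "\<dots> = (\<Sum>S | card S = k. minor S id (M ** transpose M))"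
      by (simp add: principal_minor_gram)
    finally show "(\<Sum>S | S \<in> UNIV \<and> card S = k. ?f S) = monom ((-1) ^ k * sum_sq_minors k M) (CARD('n) - k)"
      by (simp add: sum_distrib_left monom_sum)
  qed
  finally show ?thesis .
qed

lemma coeff_charpoly_gram:
  fixes M :: "real^'n^'n"
  assumes "k \<le> CARD('n)"
  shows "coeff (charpoly (M ** transpose M)) (CARD('n) - k) = (-1) ^ k * sum_sq_minors k M"
proof -
  have "coeff (charpoly (M ** transpose M)) (CARD('n) - k) =
      (\<Sum>i\<le>CARD('n). if i = k then (-1) ^ k * sum_sq_minors k M else 0)"
    unfolding charpoly_gram coeff_sum using assms
    by (intro sum.cong) auto
  thus ?thesis using assms by simp
qed

section \<open>Minors after scaling or permuting rows and columns\<close>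

lemma minor_scale_rows:
  assumes "\<And>i j. M' $ i $ j = s i * M $ i $ j"
  shows "minor S \<beta> M' = (\<Prod>i\<in>S. s i) * minor S \<beta> M"
  by (simp add: minor_def assms prod.distrib sum_distrib_left mult_ac)

lemma minor_scale_columns:
  fixes M M' :: "real^'n^'n"
  assumes "bij \<beta>" "\<And>i j. M' $ i $ j = M $ i $ j * s j"
  shows "minor S \<beta> M' = (\<Prod>j\<in>\<beta> ` S. s j) * minor S \<beta> M"
proof -
  have "(\<Prod>i\<in>S. s (\<beta> (\<pi> i))) = (\<Prod>j\<in>\<beta> ` S. s j)" if "\<pi> permutes S" for \<pi>
    using prod.permute[OF that, of "\<lambda>i. s (\<beta> i)"] assms(1)
    by (simp add: prod.reindex inj_on_subset[OF bij_is_inj] o_def)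
  thus ?thesis
    by (simp add: minor_def assms(2) prod.distrib sum_distrib_left mult_ac)
qed

text \<open>Conjugation by \<open>f\<close> is inverted by conjugation by its inverse. It reindexes
  the Leibniz sum when the row set is moved.\<close>

lemma bij_betw_map_permutation:
  assumes f: "bij_betw f A B"
  shows "bij_betw (map_permutation A f) {\<pi>. \<pi> permutes A} {\<pi>. \<pi> permutes B}"
proof (rule bij_betw_byWitness[where f' = "map_permutation B (inv_into A f)"])
  note g = bij_betw_inv_into[OF f]
  show "\<forall>\<pi>\<in>{\<pi>. \<pi> permutes A}. map_permutation B (inv_into A f) (map_permutation A f \<pi>) = \<pi>"
  proof clarify
    fix \<pi> assume p: "\<pi> permutes A"
    have "map_permutation B (inv_into A f) (map_permutation A f \<pi>) = map_permutation A (inv_into A f \<circ> f) \<pi>"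
      using f g by (intro map_permutation_compose) (auto simp: bij_betw_def)
    also have "\<dots> = map_permutation A id \<pi>"
      using f p by (intro map_permutation_cong) (auto simp: bij_betw_def inj_on_def)
    finally show "map_permutation B (inv_into A f) (map_permutation A f \<pi>) = \<pi>" using p by simp
  qed
  show "\<forall>\<pi>\<in>{\<pi>. \<pi> permutes B}. map_permutation A f (map_permutation B (inv_into A f) \<pi>) = \<pi>"
  proof clarify
    fix \<pi> assume p: "\<pi> permutes B"
    have "map_permutation A f (map_permutation B (inv_into A f) \<pi>) = map_permutation B (f \<circ> inv_into A f) \<pi>"
      using f g by (intro map_permutation_compose) (auto simp: bij_betw_def)
    also have "\<dots> = map_permutation B id \<pi>"
      using f p by (intro map_permutation_cong) (auto simp: bij_betw_def f_inv_into_f inj_on_def)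
    finally show "map_permutation A f (map_permutation B (inv_into A f) \<pi>) = \<pi>" using p by simp
  qed
qed (use map_permutation_permutes[OF f] map_permutation_permutes[OF bij_betw_inv_into[OF f]] in auto)

lemma minor_permute_rows:
  fixes M M' :: "real^'n^'n"
  assumes \<rho>: "bij \<rho>" and M': "\<And>i j. M' $ i $ j = M $ \<rho> i $ j"
  shows "minor S \<beta> M' = minor (\<rho> ` S) (\<beta> \<circ> inv \<rho>) M"
proof -
  have inj: "inj_on \<rho> S" using \<rho> by (simp add: inj_on_subset[OF bij_is_inj])
  hence b: "bij_betw \<rho> S (\<rho> ` S)" by (simp add: bij_betw_def)
  have "minor (\<rho> ` S) (\<beta> \<circ> inv \<rho>) M = (\<Sum>\<pi> | \<pi> permutes S. of_int (sign (map_permutation S \<rho> \<pi>)) *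
      (\<Prod>i\<in>\<rho> ` S. M $ i $ (\<beta> \<circ> inv \<rho>) (map_permutation S \<rho> \<pi> i)))"
    unfolding minor_def by (rule sum.reindex_bij_betw[OF bij_betw_map_permutation[OF b], symmetric])
  also have "\<dots> = minor S \<beta> M'"
    unfolding minor_def
  proof (rule sum.cong[OF refl])
    fix \<pi> assume "\<pi> \<in> {\<pi>. \<pi> permutes S}"
    hence p: "\<pi> permutes S" by simp
    have "(\<Prod>i\<in>\<rho> ` S. M $ i $ (\<beta> \<circ> inv \<rho>) (map_permutation S \<rho> \<pi> i)) = (\<Prod>i\<in>S. M' $ i $ \<beta> (\<pi> i))"
      unfolding prod.reindex[OF inj] using inv_f_f[OF bij_is_inj[OF \<rho>]] inj
      by (intro prod.cong) (simp_all add: map_permutation_def restrict_id_def M')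
    thus "of_int (sign (map_permutation S \<rho> \<pi>)) *
        (\<Prod>i\<in>\<rho> ` S. M $ i $ (\<beta> \<circ> inv \<rho>) (map_permutation S \<rho> \<pi> i)) =
      of_int (sign \<pi>) * (\<Prod>i\<in>S. M' $ i $ \<beta> (\<pi> i))"
      using p inj by (simp add: sign_map_permutation)
  qed
  finally show ?thesis ..
qed

lemma minor_permute_columns:
  assumes "\<And>i j. M' $ i $ j = M $ i $ \<rho> j"
  shows "minor S \<beta> M' = minor S (\<rho> \<circ> \<beta>) M"
  by (simp add: minor_def assms)

section \<open>Second moments of minors under a bi-invariant law\<close>

definition sign_flip :: "'n \<Rightarrow> real^'n^'n" where
  "sign_flip k = (\<chi> i j. if i = j then (if i = k then -1 else 1) else 0)"

definition permutation_matrix :: "('n \<Rightarrow> 'n) \<Rightarrow> real^'n^'n" where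
  "permutation_matrix \<rho> = (\<chi> i j. if j = \<rho> i then 1 else 0)"

lemma sign_flip_mult:
  "(sign_flip k ** M) $ i $ j = (if i = k then -1 else 1) * M $ i $ j"
  "(M ** sign_flip k) $ i $ j = M $ i $ j * (if j = k then -1 else 1)"
  by (simp_all add: sign_flip_def matrix_matrix_mult_def if_distrib[where f = "\<lambda>x. x * _"]
      if_distrib[where f = "\<lambda>x. _ * x"] cong: if_cong)

lemma orthogonal_sign_flip: "orthogonal_matrix (sign_flip k)"
proof -
  have "transpose (sign_flip k) = sign_flip k"
    by (auto simp: vec_eq_iff transpose_def sign_flip_def)
  moreover have "sign_flip k ** sign_flip k = mat 1"
    unfolding vec_eq_iff sign_flip_mult by (simp add: sign_flip_def mat_def)
  ultimately show ?thesis by (simp add: orthogonal_matrix)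
qed

lemma permutation_matrix_mult:
  "(permutation_matrix \<rho> ** M) $ i $ j = M $ \<rho> i $ j"
  "(M ** transpose (permutation_matrix \<rho>)) $ i $ j = M $ i $ \<rho> j"
  by (simp_all add: permutation_matrix_def matrix_matrix_mult_def transpose_def
      if_distrib[where f = "\<lambda>x. x * _"] if_distrib[where f = "\<lambda>x. _ * x"] cong: if_cong)

lemma orthogonal_permutation_matrix:
  assumes "bij \<rho>"
  shows "orthogonal_matrix (permutation_matrix \<rho>)"
proof -
  have "permutation_matrix \<rho> ** transpose (permutation_matrix \<rho>) = mat 1"
    unfolding vec_eq_iff permutation_matrix_mult
    using assms by (auto simp: permutation_matrix_def mat_def bij_def inj_def)
  thus ?thesis
    by (metis matrix_left_right_inverse orthogonal_matrix)
qed

lemma continuous_on_minor: "continuous_on UNIV (minor S \<beta>)"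
  unfolding minor_def by (intro continuous_intros)

text \<open>Removing \<open>U\<close> leaves an arbitrary subset of the complement of size
  \<open>k - card U\<close>.\<close>

lemma card_supersets:
  fixes U :: "'n::finite set"
  assumes "card U \<le> k"
  shows "card {S. U \<subseteq> S \<and> card S = k} = (CARD('n) - card U) choose (k - card U)"
proof -
  have "bij_betw (\<lambda>S. S - U) {S. U \<subseteq> S \<and> card S = k} {W. W \<subseteq> - U \<and> card W = k - card U}"
  proof (rule bij_betw_byWitness[where f' = "\<lambda>W. W \<union> U"])
    show "(\<lambda>W. W \<union> U) ` {W. W \<subseteq> - U \<and> card W = k - card U} \<subseteq> {S. U \<subseteq> S \<and> card S = k}"
    proof clarify
      fix W assume "W \<subseteq> - U" "card W = k - card U"
      hence "card (W \<union> U) = k" using assms by (subst card_Un_disjoint) auto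
      thus "U \<subseteq> W \<union> U \<and> card (W \<union> U) = k" by auto
    qed
  qed (auto simp: card_Diff_subset)
  hence "card {S. U \<subseteq> S \<and> card S = k} = card {W. W \<subseteq> - U \<and> card W = k - card U}"
    by (rule bij_betw_same_card)
  also have "\<dots> = (CARD('n) - card U) choose (k - card U)"
    by (simp add: n_subsets Compl_eq_Diff_UNIV card_Diff_subset)
  finally show ?thesis .
qed

text \<open>This isolates what is needed of the law of \<open>R ** B ** Q\<close>. The last
  assumption takes the place of compact support and makes all polynomial functions of the entries
  integrable.\<close>

locale biinvariant_law = prob_space \<nu> for \<nu> :: "(real^'n^'n) measure" +
  assumes sets_law [measurable_cong]: "sets \<nu> = sets borel"
    and left_invariant: "orthogonal_matrix V \<Longrightarrow> distr \<nu> borel (\<lambda>C. V ** C) = \<nu>"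
    and right_invariant: "orthogonal_matrix V \<Longrightarrow> distr \<nu> borel (\<lambda>C. C ** V) = \<nu>"
    and integrable_continuous: "continuous_on UNIV g \<Longrightarrow> integrable \<nu> (g :: real^'n^'n \<Rightarrow> real)"
begin

lemma integral_left:
  assumes "continuous_on UNIV (g :: real^'n^'n \<Rightarrow> real)" "orthogonal_matrix V"
  shows "(\<integral>C. g (V ** C) \<partial>\<nu>) = (\<integral>C. g C \<partial>\<nu>)"
proof -
  have [measurable]: "g \<in> borel_measurable borel" 
    using assms by (intro borel_measurable_continuous_onI)
  have "(\<integral>C. g C \<partial>distr \<nu> borel (\<lambda>C. V ** C)) = (\<integral>C. g (V ** C) \<partial>\<nu>)"
    by (intro integral_distr) auto
  thus ?thesis using left_invariant[OF assms(2)] by simp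
qed

lemma integral_right:
  assumes "continuous_on UNIV (g :: real^'n^'n \<Rightarrow> real)" "orthogonal_matrix V"
  shows "(\<integral>C. g (C ** V) \<partial>\<nu>) = (\<integral>C. g C \<partial>\<nu>)"
proof -
  have [measurable]: "g \<in> borel_measurable borel" 
    using assms by (intro borel_measurable_continuous_onI)
  have "(\<integral>C. g C \<partial>distr \<nu> borel (\<lambda>C. C ** V)) = (\<integral>C. g (C ** V) \<partial>\<nu>)"
    by (intro integral_distr) auto
  thus ?thesis using right_invariant[OF assms(2)] by simp
qed

text \<open>Some row, or else some column, belongs to exactly one of the two minors. Flipping its
  sign preserves the law and negates the product, so the integral equals its own negative.\<close>

lemma integral_minors_orthogonal:
  assumes "card I = card J" "card I' = card J'" "(I, J) \<noteq> (I', J')"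
  shows "(\<integral>C. set_minor I J C * set_minor I' J' C \<partial>\<nu>) = 0"
proof -
  let ?g = "\<lambda>C. set_minor I J C * set_minor I' J' C"
  have cont: "continuous_on UNIV ?g"
    by (intro continuous_on_mult continuous_on_minor)
  have prod_flip: "(\<Prod>i\<in>K. (if i = k then -1 else 1)) = (if k \<in> K then -1 else (1::real))" for K :: "'n set" and k
    by (simp add: prod.delta)
  show ?thesis
  proof (cases "I = I'")
    case False
    then obtain k where k: "(k \<in> I) \<noteq> (k \<in> I')" by blast
    have "minor S \<beta> (sign_flip k ** C) = (if k \<in> S then -1 else 1) * minor S \<beta> C" for S \<beta> C
      by (subst minor_scale_rows[OF sign_flip_mult(1)]) (simp only: prod_flip)
    hence "?g (sign_flip k ** C) = - ?g C" for C using k by auto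
    hence "(\<integral>C. - ?g C \<partial>\<nu>) = (\<integral>C. ?g C \<partial>\<nu>)"
      using integral_left[OF cont orthogonal_sign_flip[of k]] by simp
    thus ?thesis by simp
  next
    case True
    with assms obtain k where k: "(k \<in> J) \<noteq> (k \<in> J')" by blast
    \<comment> \<open>Equal sizes are needed here, since only then is \<open>T\<close> the column
      set of \<open>set_minor S T\<close>.\<close>
    have "set_minor S T (C ** sign_flip k) = (if k \<in> T then -1 else 1) * set_minor S T C"
      if "card S = card T" for S T C
      by (subst minor_scale_columns[OF matching(1)[OF that] sign_flip_mult(2)])
        (simp only: prod_flip matching(2)[OF that])
    hence "?g (C ** sign_flip k) = - ?g C" for C using k assms(1,2) by auto
    hence "(\<integral>C. - ?g C \<partial>\<nu>) = (\<integral>C. ?g C \<partial>\<nu>)"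
      using integral_right[OF cont orthogonal_sign_flip[of k]] by simp
    thus ?thesis by simp
  qed
qed

text \<open>A permutation matrix on the left carries \<open>I\<close> to \<open>I'\<close>, then one
  on the right carries \<open>J\<close> to \<open>J'\<close>. The permuted minor may use another
  column bijection than the chosen matching, but squaring removes the resulting sign.\<close>

lemma integral_minor_sq_cong:
  assumes c: "card I = j" "card J = j" "card I' = j" "card J' = j"
  shows "(\<integral>C. (set_minor I J C)\<^sup>2 \<partial>\<nu>) = (\<integral>C. (set_minor I' J' C)\<^sup>2 \<partial>\<nu>)"
proof -
  have cont: "continuous_on UNIV (\<lambda>C. (minor S \<beta> C)\<^sup>2)" for S \<beta>
    by (intro continuous_on_power continuous_on_minor)
  have IJ: "card I = card J" and IJ': "card I' = card J'" and I'J: "card I' = card J" using c by auto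
  define \<rho> where "\<rho> = matching I I'"
  define \<tau> where "\<tau> = matching J J'"
  have \<rho>: "bij \<rho>" "\<rho> ` I = I'" and \<tau>: "bij \<tau>" "\<tau> ` J = J'"
    using matching[of I I'] matching[of J J'] c by (auto simp: \<rho>_def \<tau>_def)
  have "(set_minor I J (permutation_matrix \<rho> ** C))\<^sup>2 = (set_minor I' J C)\<^sup>2" for C
  proof -
    have "set_minor I J (permutation_matrix \<rho> ** C) = minor I' (matching I J \<circ> inv \<rho>) C"
      using minor_permute_rows[OF \<rho>(1) permutation_matrix_mult(1)] \<rho>(2) by simp
    moreover have "inv \<rho> ` I' = I"
      using \<rho> image_inv_f_f[OF bij_is_inj[OF \<rho>(1)], of I] by simp
    hence "(matching I J \<circ> inv \<rho>) ` I' = matching I' J ` I'"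
      using matching(2)[OF IJ] matching(2)[OF I'J] by (simp only: image_comp[symmetric])
    moreover have "bij (matching I J \<circ> inv \<rho>)"
      using matching(1)[OF IJ] \<rho>(1) by (simp add: bij_comp bij_imp_bij_inv)
    ultimately show ?thesis
      using minor_power2_eq[OF matching(1)[OF I'J]] by simp
  qed
  hence 1: "(\<integral>C. (set_minor I J C)\<^sup>2 \<partial>\<nu>) = (\<integral>C. (set_minor I' J C)\<^sup>2 \<partial>\<nu>)"
    using integral_left[OF cont[of I "matching I J"] orthogonal_permutation_matrix[OF \<rho>(1)]]
    by (simp only:)
  have "(set_minor I' J (C ** transpose (permutation_matrix \<tau>)))\<^sup>2 = (set_minor I' J' C)\<^sup>2" for C
  proof -
    have "set_minor I' J (C ** transpose (permutation_matrix \<tau>)) = minor I' (\<tau> \<circ> matching I' J) C"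
      by (rule minor_permute_columns[OF permutation_matrix_mult(2)])
    moreover have "(\<tau> \<circ> matching I' J) ` I' = matching I' J' ` I'"
      using matching(2)[OF I'J] matching(2)[OF IJ'] \<tau>(2) by (simp only: image_comp[symmetric])
    moreover have "bij (\<tau> \<circ> matching I' J)"
      using matching(1)[OF I'J] \<tau>(1) by (simp add: bij_comp)
    ultimately show ?thesis
      using minor_power2_eq[OF matching(1)[OF IJ']] by simp
  qed
  moreover have ort: "orthogonal_matrix (transpose (permutation_matrix \<tau>))"
    using orthogonal_permutation_matrix[OF \<tau>(1)] by simp
  ultimately have "(\<integral>C. (set_minor I' J C)\<^sup>2 \<partial>\<nu>) = (\<integral>C. (set_minor I' J' C)\<^sup>2 \<partial>\<nu>)"
    using integral_right[OF cont[of I' "matching I' J"] ort] by (simp only:)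
  with 1 show ?thesis by simp
qed

text \<open>The second moments of all minors of size \<open>j\<close> coincide, so each is the mean
  of their sum over the \<open>(d choose j)\<^sup>2\<close> pairs of index sets.\<close>

lemma integral_minor_sq:
  assumes "card I = j" "card J = j"
  shows "(\<integral>C. (set_minor I J C)\<^sup>2 \<partial>\<nu>) = (\<integral>C. sum_sq_minors j C \<partial>\<nu>) / real (CARD('n) choose j) ^ 2"
proof -
  have int: "integrable \<nu> (\<lambda>C. (minor S \<beta> C)\<^sup>2)" for S \<beta>
    by (intro integrable_continuous continuous_on_power continuous_on_minor)
  let ?X = "{(S, T). card S = j \<and> card (T :: 'n set) = j} :: ('n set \<times> 'n set) set"
  have "(\<integral>C. sum_sq_minors j C \<partial>\<nu>) = (\<Sum>(S, T)\<in>?X. \<integral>C. (set_minor S T C)\<^sup>2 \<partial>\<nu>)"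
    unfolding sum_sq_minors_def case_prod_unfold using int by (intro Bochner_Integration.integral_sum) auto
  also have "\<dots> = (\<Sum>(S, T)\<in>?X. \<integral>C. (set_minor I J C)\<^sup>2 \<partial>\<nu>)"
  proof -
    have "(\<integral>C. (set_minor S T C)\<^sup>2 \<partial>\<nu>) = (\<integral>C. (set_minor I J C)\<^sup>2 \<partial>\<nu>)" if "(S, T) \<in> ?X" for S T
      using that assms by (intro integral_minor_sq_cong[of _ j]) auto
    thus ?thesis by (intro sum.cong refl) (simp only: split_paired_all prod.case)
  qed
  also have "\<dots> = real (card ?X) * (\<integral>C. (set_minor I J C)\<^sup>2 \<partial>\<nu>)"
    by (simp add: case_prod_unfold)
  also have "?X = {S. card S = j} \<times> {T. card T = j}" by auto
  also have "card \<dots> = (CARD('n) choose j) ^ 2"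
    using n_subsets[of "UNIV :: 'n set" j] by (simp add: card_cartesian_product power2_eq_square)
  finally have "(\<integral>C. sum_sq_minors j C \<partial>\<nu>) = real (CARD('n) choose j) ^ 2 * (\<integral>C. (set_minor I J C)\<^sup>2 \<partial>\<nu>)"
    by simp
  moreover have "j \<le> CARD('n)" using assms by (auto intro: card_mono)
  hence "CARD('n) choose j > 0" by simp
  ultimately show ?thesis by simp
qed

text \<open>Squaring the Laplace expansion gives a double sum whose off-diagonal terms integrate to
  zero; on the diagonal the signs square to 1.\<close>

lemma integral_minor_sq_add:
  fixes A :: "real^'n^'n"
  assumes "card S = k" "card T = k"
  shows "(\<integral>C. (set_minor S T (A + C))\<^sup>2 \<partial>\<nu>) =
    (\<Sum>(U, V) | U \<subseteq> S \<and> V \<subseteq> T \<and> card U = card V.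
      (set_minor U V A)\<^sup>2 * ((\<integral>C. sum_sq_minors (k - card U) C \<partial>\<nu>) / real (CARD('n) choose (k - card U)) ^ 2))"
proof -
  have ST: "card S = card T" using assms by simp
  note m = matching[OF ST]
  let ?P = "{(U, V). U \<subseteq> S \<and> V \<subseteq> T \<and> card U = card V}"
  obtain \<epsilon> where \<epsilon>: "\<And>U V. \<epsilon> U V \<in> {1, -1 :: real}"
    and lap: "\<And>A C. set_minor S T (A + C) =
      (\<Sum>(U, V) | U \<subseteq> S \<and> V \<subseteq> T \<and> card U = card V.
        \<epsilon> U V * set_minor U V A * set_minor (S - U) (T - V) C)"
    using minor_add_laplace[OF m(1), of S thesis] unfolding m(2) by blast
  \<comment> \<open>The signs and the minors of \<open>A\<close> are constants of integration; only
    the minors of \<open>C\<close> in \<open>c\<close> are random.\<close>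
  define a where "a = (\<lambda>(U, V). \<epsilon> U V * set_minor U V A)"
  define c where "c = (\<lambda>(U, V). set_minor (S - U) (T - V))"
  have cont: "continuous_on UNIV (c x)" for x
    by (auto simp: c_def case_prod_unfold intro: continuous_on_minor)
  have "(\<integral>C. (set_minor S T (A + C))\<^sup>2 \<partial>\<nu>) = (\<integral>C. (\<Sum>x\<in>?P. \<Sum>y\<in>?P. a x * a y * (c x C * c y C)) \<partial>\<nu>)"
    by (simp add: lap a_def c_def case_prod_unfold power2_eq_square sum_product mult_ac)
  also have "\<dots> = (\<Sum>x\<in>?P. \<Sum>y\<in>?P. a x * a y * (\<integral>C. c x C * c y C \<partial>\<nu>))"
    by (simp add: integrable_continuous cont continuous_on_mult Bochner_Integration.integral_sum)
  also have "\<dots> = (\<Sum>x\<in>?P. \<Sum>y\<in>?P. if x = y then (a x)\<^sup>2 * (\<integral>C. (c x C)\<^sup>2 \<partial>\<nu>) else 0)"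
  proof (intro sum.cong refl)
    fix x y assume xy: "x \<in> ?P" "y \<in> ?P"
    obtain U V U' V' where x: "x = (U, V)" and y: "y = (U', V')" by (metis surj_pair)
    have UV: "U \<subseteq> S" "V \<subseteq> T" "card U = card V" "U' \<subseteq> S" "V' \<subseteq> T" "card U' = card V'"
      using xy x y by auto
    \<comment> \<open>Within \<open>S\<close> and \<open>T\<close>, distinct pairs have distinct
      pairs of complements, so the orthogonality of minors applies.\<close>
    have "(\<integral>C. c x C * c y C \<partial>\<nu>) = 0" if "x \<noteq> y"
      unfolding c_def x y prod.case
    proof (rule integral_minors_orthogonal)
      show "card (S - U) = card (T - V)" "card (S - U') = card (T - V')"
        using UV ST by (simp_all add: card_Diff_subset)
      show "(S - U, T - V) \<noteq> (S - U', T - V')"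
        using that UV x y by blast
    qed
    thus "a x * a y * (\<integral>C. c x C * c y C \<partial>\<nu>) = (if x = y then (a x)\<^sup>2 * (\<integral>C. (c x C)\<^sup>2 \<partial>\<nu>) else 0)"
      by (simp add: power2_eq_square)
  qed
  also have "\<dots> = (\<Sum>x\<in>?P. (a x)\<^sup>2 * (\<integral>C. (c x C)\<^sup>2 \<partial>\<nu>))"
    by simp
  also have "\<dots> = (\<Sum>(U, V)\<in>?P.
      (set_minor U V A)\<^sup>2 * ((\<integral>C. sum_sq_minors (k - card U) C \<partial>\<nu>) / real (CARD('n) choose (k - card U)) ^ 2))"
  proof (intro sum.cong refl, clarify)
    fix U V assume UV: "U \<subseteq> S" "V \<subseteq> T" "card U = card V"
    have "(\<epsilon> U V)\<^sup>2 = 1" using \<epsilon>[of U V] by auto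
    moreover have "(\<integral>C. (set_minor (S - U) (T - V) C)\<^sup>2 \<partial>\<nu>) =
        (\<integral>C. sum_sq_minors (k - card U) C \<partial>\<nu>) / real (CARD('n) choose (k - card U)) ^ 2"
      using UV assms by (intro integral_minor_sq) (simp_all add: card_Diff_subset)
    ultimately show "(a (U, V))\<^sup>2 * (\<integral>C. (c (U, V) C)\<^sup>2 \<partial>\<nu>) =
      (set_minor U V A)\<^sup>2 * ((\<integral>C. sum_sq_minors (k - card U) C \<partial>\<nu>) / real (CARD('n) choose (k - card U)) ^ 2)"
      by (simp add: a_def c_def power_mult_distrib)
  qed
  finally show ?thesis .
qed

text \<open>Double counting: the sum over pairs \<open>(S, T)\<close> of size \<open>k\<close> and
  their subpairs \<open>(U, V)\<close> is taken over \<open>(U, V)\<close> first. A subpair of size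
  \<open>i\<close> lies in \<open>((d - i) choose (k - i))\<^sup>2\<close> pairs.\<close>

lemma integral_sum_sq_minors_add:
  fixes A :: "real^'n^'n"
  shows "(\<integral>C. sum_sq_minors k (A + C) \<partial>\<nu>) =
    (\<Sum>i\<le>k. (real ((CARD('n) - i) choose (k - i)) / real (CARD('n) choose (k - i)))\<^sup>2 *
      sum_sq_minors i A * (\<integral>C. sum_sq_minors (k - i) C \<partial>\<nu>))"
proof -
  define w where "w i = (\<integral>C. sum_sq_minors (k - i) C \<partial>\<nu>) / real (CARD('n) choose (k - i)) ^ 2" for i
  let ?X = "{(S, T). card S = k \<and> card (T :: 'n set) = k} :: ('n set \<times> 'n set) set"
  let ?Y = "{(U, V). card U \<le> k \<and> card U = card (V :: 'n set)} :: ('n set \<times> 'n set) set"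
  let ?h = "\<lambda>(U, V). (set_minor U V A)\<^sup>2 * w (card U)"
  let ?R = "\<lambda>x y. fst y \<subseteq> fst x \<and> snd y \<subseteq> snd x"
  have int: "integrable \<nu> (\<lambda>C. (minor S \<beta> (A + C))\<^sup>2)" for S \<beta>
    by (intro integrable_continuous continuous_on_power continuous_on_compose2[OF continuous_on_minor])
      (auto intro!: continuous_intros)
  have "(\<integral>C. sum_sq_minors k (A + C) \<partial>\<nu>) = (\<Sum>(S, T)\<in>?X. \<integral>C. (set_minor S T (A + C))\<^sup>2 \<partial>\<nu>)"
    unfolding sum_sq_minors_def case_prod_unfold using int by (intro Bochner_Integration.integral_sum) auto
  also have "\<dots> = (\<Sum>x\<in>?X. \<Sum>y | y \<in> ?Y \<and> ?R x y. ?h y)"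
  proof -
    have "(\<integral>C. (set_minor S T (A + C))\<^sup>2 \<partial>\<nu>) = (\<Sum>y | y \<in> ?Y \<and> ?R (S, T) y. ?h y)"
      if "(S, T) \<in> ?X" for S T
    proof -
      have ST: "card S = k" "card T = k" using that by auto
      \<comment> \<open>The size bound built into \<open>?Y\<close> is automatic for subpairs, since
        \<open>V\<close> lies in \<open>T\<close>.\<close>
      have "{(U, V). U \<subseteq> S \<and> V \<subseteq> T \<and> card U = card V} = {y. y \<in> ?Y \<and> ?R (S, T) y}"
        using card_mono[of T] ST(2) by auto
      thus ?thesis
        unfolding integral_minor_sq_add[OF ST] w_def by (rule sum.cong) (rule refl)
    qed
    thus ?thesis by (intro sum.cong refl) (simp only: split_paired_all prod.case)
  qed
  also have "\<dots> = (\<Sum>y\<in>?Y. \<Sum>x | x \<in> ?X \<and> ?R x y. ?h y)"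
    by (rule sum.swap_restrict) auto
  also have "\<dots> = (\<Sum>(U, V)\<in>?Y. real ((CARD('n) - card U) choose (k - card U)) ^ 2 * ((set_minor U V A)\<^sup>2 * w (card U)))"
  proof -
    have "(\<Sum>x | x \<in> ?X \<and> ?R x (U, V). ?h (U, V)) =
        real ((CARD('n) - card U) choose (k - card U)) ^ 2 * ((set_minor U V A)\<^sup>2 * w (card U))"
      if "(U, V) \<in> ?Y" for U V
    proof -
      have UV: "card U \<le> k" "card V = card U" using that by auto
      have "{x. x \<in> ?X \<and> ?R x (U, V)} = {S. U \<subseteq> S \<and> card S = k} \<times> {T. V \<subseteq> T \<and> card T = k}"
        by auto
      hence "card {x. x \<in> ?X \<and> ?R x (U, V)} = ((CARD('n) - card U) choose (k - card U)) ^ 2"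
        using UV by (simp add: card_cartesian_product card_supersets power2_eq_square)
      thus ?thesis by simp
    qed
    thus ?thesis by (intro sum.cong refl) (simp only: split_paired_all prod.case)
  qed
  \<comment> \<open>The weight depends only on the size of \<open>U\<close>, so sorting by size
    produces \<open>sum_sq_minors i A\<close>.\<close>
  also have "\<dots> = (\<Sum>i\<le>k. \<Sum>y | y \<in> ?Y \<and> card (fst y) = i. (\<lambda>(U, V).
       real ((CARD('n) - card U) choose (k - card U)) ^ 2 * ((set_minor U V A)\<^sup>2 * w (card U))) y)"
    by (intro sum.group[symmetric]) auto
  also have "\<dots> = (\<Sum>i\<le>k. real ((CARD('n) - i) choose (k - i)) ^ 2 * w i * sum_sq_minors i A)"
  proof (rule sum.cong[OF refl])
    fix i assume "i \<in> {..k}"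
    hence "{y. y \<in> ?Y \<and> card (fst y) = i} = {(U, V). card U = i \<and> card V = i}" by auto
    thus "(\<Sum>y | y \<in> ?Y \<and> card (fst y) = i. (\<lambda>(U, V).
       real ((CARD('n) - card U) choose (k - card U)) ^ 2 * ((set_minor U V A)\<^sup>2 * w (card U))) y) =
       real ((CARD('n) - i) choose (k - i)) ^ 2 * w i * sum_sq_minors i A"
      unfolding sum_sq_minors_def sum_distrib_left
      by (intro sum.cong) (auto simp: mult_ac)
  qed
  finally show ?thesis
    by (simp add: w_def power_divide mult_ac)
qed

end

section \<open>The law of a randomly rotated matrix\<close>

text \<open>Rows of unit length give boundedness, and the defining equation is closed. Compactness
  later bounds continuous functions of \<open>R ** B ** Q\<close>.\<close>

lemma compact_orthogonal_matrices: "compact {U :: real^'n^'n. orthogonal_matrix U}"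
proof (rule compact_eq_bounded_closed[THEN iffD2], rule conjI)
  have "norm U \<le> real CARD('n)" if "orthogonal_matrix U" for U :: "real^'n^'n"
  proof -
    have "norm (U $ i) = 1" for i
      using that by (simp add: orthogonal_matrix_orthonormal_rows row_def)
    thus ?thesis
      using L2_set_le_sum[of UNIV "\<lambda>i. norm (U $ i)"] by (simp add: norm_vec_def)
  qed
  thus "bounded {U :: real^'n^'n. orthogonal_matrix U}"
    by (auto simp: bounded_iff)
  have "continuous_on UNIV (\<lambda>U :: real^'n^'n. transpose U ** U)"
    unfolding matrix_matrix_mult_def transpose_def
    by (intro continuous_on_vec_lambda continuous_intros)
  hence "closed ((\<lambda>U :: real^'n^'n. transpose U ** U) -` {mat 1})"
    by (intro closed_vimage) auto
  thus "closed {U :: real^'n^'n. orthogonal_matrix U}"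
    by (simp add: orthogonal_matrix vimage_def)
qed

text \<open>Conjugation by \<open>R\<close> fixes \<open>xI\<close>, so it acts on
  \<open>xI - N\<close> as a whole and leaves the determinant unchanged.\<close>

lemma charpoly_orthogonal_similarity:
  fixes N :: "real^'n^'n"
  assumes "orthogonal_matrix R"
  shows "charpoly (R ** N ** transpose R) = charpoly N"
proof (rule poly_eq_poly_eq_iff[THEN iffD1], rule ext)
  fix x :: real
  have ldist: "X ** (Y - Z) = X ** Y - X ** Z" and rdist: "(Y - Z) ** X = Y ** X - Z ** X"
    for X Y Z :: "real^'n^'n"
    by (simp_all add: vec_eq_iff matrix_matrix_mult_def algebra_simps sum_subtractf)
  have RR: "R ** transpose R = mat 1" using assms by (simp add: orthogonal_matrix_def)
  have "R ** mat x = x *\<^sub>R R"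
    by (simp add: vec_eq_iff matrix_matrix_mult_def mat_def if_distrib[where f = "\<lambda>y. _ * y"] mult.commute cong: if_cong)
  moreover have "mat x = x *\<^sub>R (mat 1 :: real^'n^'n)"
    by (simp add: vec_eq_iff mat_def)
  ultimately have "R ** mat x ** transpose R = mat x"
    using RR by (simp add: scalar_matrix_assoc[symmetric])
  hence "mat x - R ** N ** transpose R = R ** (mat x - N) ** transpose R"
    by (simp add: ldist rdist)
  hence "det (mat x - R ** N ** transpose R) = det (mat x - N) * det (R ** transpose R)"
    by (simp add: det_mul)
  thus "poly (charpoly (R ** N ** transpose R)) x = poly (charpoly N) x"
    by (simp add: poly_charpoly RR)
qed

text \<open>In the Gram matrix \<open>Q\<close> cancels and \<open>R\<close> acts by conjugation;
  the quantity is, up to sign, a coefficient of its characteristic polynomial.\<close>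

lemma sum_sq_minors_orthogonal:
  fixes B :: "real^'n^'n"
  assumes "orthogonal_matrix R" "orthogonal_matrix Q" "k \<le> CARD('n)"
  shows "sum_sq_minors k (R ** B ** Q) = sum_sq_minors k B"
proof -
  have "(R ** B ** Q) ** transpose (R ** B ** Q) = R ** B ** (Q ** transpose Q) ** transpose B ** transpose R"
    by (simp add: matrix_transpose_mul matrix_mul_assoc)
  also have "\<dots> = R ** (B ** transpose B) ** transpose R"
    using assms(2) by (simp add: orthogonal_matrix_def matrix_mul_assoc)
  finally have "charpoly ((R ** B ** Q) ** transpose (R ** B ** Q)) = charpoly (B ** transpose B)"
    using charpoly_orthogonal_similarity[OF assms(1)] by simp
  thus ?thesis
    using coeff_charpoly_gram[OF assms(3), of "R ** B ** Q"] coeff_charpoly_gram[OF assms(3), of B] by simp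
qed

abbreviation haar_pair :: "((real^'n^'n) \<times> (real^'n^'n)) measure" where
  "haar_pair \<equiv> haar_orthogonal \<Otimes>\<^sub>M haar_orthogonal"

definition rotated_law :: "real^'n^'n \<Rightarrow> (real^'n^'n) measure" where
  "rotated_law B = distr haar_pair borel (\<lambda>(R, Q). R ** B ** Q)"

lemma haar_orthogonal:
  shows prob_space_haar: "prob_space (haar_orthogonal :: (real^'n^'n) measure)"
    and sets_haar [measurable_cong]: "sets (haar_orthogonal :: (real^'n^'n) measure) = sets borel"
    and AE_haar: "AE U in (haar_orthogonal :: (real^'n^'n) measure). orthogonal_matrix U"
    and haar_left_invariant: "orthogonal_matrix (V :: real^'n^'n) \<Longrightarrow>
      distr haar_orthogonal borel (\<lambda>U. V ** U) = haar_orthogonal"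
  using is_haar_orthogonal_haar[where ?'n = 'n] unfolding is_haar_orthogonal_def by blast+

context
begin

interpretation haar: prob_space "haar_orthogonal :: (real^'n^'n) measure"
  by (rule prob_space_haar)

interpretation haar2: pair_prob_space "haar_orthogonal :: (real^'n^'n) measure" "haar_orthogonal :: (real^'n^'n) measure" ..

lemma measurable_rotate [measurable]:
  "(\<lambda>(R, Q). R ** B ** Q) \<in> (haar_pair :: ((real^'n^'n) \<times> _) measure) \<rightarrow>\<^sub>M borel"
  by measurable

lemma AE_haar_pair:
  "AE (R, Q) in (haar_pair :: ((real^'n^'n) \<times> _) measure). orthogonal_matrix R \<and> orthogonal_matrix Q"
proof -
  have "AE R in (haar_orthogonal :: (real^'n^'n) measure). AE Q in (haar_orthogonal :: (real^'n^'n) measure).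
      orthogonal_matrix R \<and> orthogonal_matrix Q"
    using AE_haar by eventually_elim (use AE_haar in auto)
  moreover have "{x \<in> space (haar_pair :: ((real^'n^'n) \<times> _) measure).
      orthogonal_matrix (fst x) \<and> orthogonal_matrix (snd x)} \<in> sets (haar_pair :: ((real^'n^'n) \<times> _) measure)"
  proof -
    let ?O = "{U :: real^'n^'n. orthogonal_matrix U}"
    have "{x \<in> space (haar_pair :: ((real^'n^'n) \<times> _) measure).
      orthogonal_matrix (fst x) \<and> orthogonal_matrix (snd x)} = ?O \<times> ?O"
      by (auto simp: space_pair_measure sets_eq_imp_space_eq[OF sets_haar])
    moreover have "?O \<times> ?O \<in> sets (haar_pair :: ((real^'n^'n) \<times> _) measure)"
      by (intro pair_measureI) (auto simp: sets_haar intro: sets_orthogonal_matrix)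
    ultimately show ?thesis by (simp only:)
  qed
  ultimately show ?thesis
    using haar2.AE_pair_measure[of "\<lambda>x. orthogonal_matrix (fst x) \<and> orthogonal_matrix (snd x)"]
    by (simp add: case_prod_unfold)
qed

text \<open>Left invariance is part of the definition of Haar measure, and right invariance follows
  from its uniqueness; the product measure combines the two.\<close>

lemma haar_pair_invariant:
  fixes V W :: "real^'n^'n"
  assumes "orthogonal_matrix V" "orthogonal_matrix W"
  shows "distr haar_pair (borel \<Otimes>\<^sub>M borel) (\<lambda>(R, Q). (V ** R, Q ** W)) =
    haar_pair"
proof -
  note l = haar_left_invariant[OF assms(1)]
  have r: "distr haar_orthogonal borel (\<lambda>Q. Q ** W) = haar_orthogonal"
    by (intro is_haar_orthogonal_right_invariant is_haar_orthogonal_haar assms)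
  have "distr haar_orthogonal borel (\<lambda>R. V ** R) \<Otimes>\<^sub>M distr haar_orthogonal borel (\<lambda>Q. Q ** W) =
    distr haar_pair (borel \<Otimes>\<^sub>M borel) (\<lambda>(R, Q). (V ** R, Q ** W))"
    by (rule pair_measure_distr) (auto simp: r haar.sigma_finite_measure_axioms)
  thus ?thesis by (simp add: l r)
qed

text \<open>In \<open>V ** (R ** B ** Q) ** W\<close> the outer factors are absorbed into
  \<open>R\<close> and \<open>Q\<close>.\<close>

lemma rotated_law_invariant:
  fixes B V W :: "real^'n^'n"
  assumes "orthogonal_matrix V" "orthogonal_matrix W"
  shows "distr (rotated_law B) borel (\<lambda>C. V ** C ** W) = rotated_law B"
proof -
  have "rotated_law B = distr (distr haar_pair (borel \<Otimes>\<^sub>M borel)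
      (\<lambda>(R, Q). (V ** R, Q ** W))) borel (\<lambda>(R, Q). R ** B ** Q)"
    by (simp add: rotated_law_def haar_pair_invariant[OF assms])
  also have "\<dots> = distr haar_pair borel (\<lambda>(R, Q). V ** (R ** B ** Q) ** W)"
    by (subst distr_distr) (auto simp: o_def case_prod_unfold matrix_mul_assoc)
  also have "\<dots> = distr (rotated_law B) borel (\<lambda>C. V ** C ** W)"
    unfolding rotated_law_def by (subst distr_distr) (auto simp: o_def case_prod_unfold)
  finally show ?thesis ..
qed

lemma biinvariant_rotated_law: "biinvariant_law (rotated_law (B :: real^'n^'n))"
proof -
  interpret L: prob_space "rotated_law B"
    unfolding rotated_law_def by (rule haar2.prob_space_distr) measurable
  show ?thesis
  proof
    show "sets (rotated_law B) = sets borel" by (simp add: rotated_law_def)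
    show "distr (rotated_law B) borel (\<lambda>C. V ** C) = rotated_law B" if "orthogonal_matrix V" for V
      using rotated_law_invariant[OF that orthogonal_matrix_id] by simp
    show "distr (rotated_law B) borel (\<lambda>C. C ** V) = rotated_law B" if "orthogonal_matrix V" for V
      using rotated_law_invariant[OF orthogonal_matrix_id that] by simp
    \<comment> \<open>Almost surely \<open>R ** B ** Q\<close> lies in the continuous image of a
      compact set, on which \<open>g\<close> is bounded.\<close>
    fix g :: "real^'n^'n \<Rightarrow> real" assume g: "continuous_on UNIV g"
    let ?O = "{U :: real^'n^'n. orthogonal_matrix U}"
    let ?f = "\<lambda>x. fst x ** B ** snd x"
    have "continuous_on (?O \<times> ?O) ?f"
      unfolding matrix_matrix_mult_def by (intro continuous_on_vec_lambda continuous_intros)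
    hence "continuous_on (?O \<times> ?O) (\<lambda>x. g (?f x))"
      by (rule continuous_on_compose2[OF g]) auto
    moreover have "compact (?O \<times> ?O)"
      by (intro compact_Times compact_orthogonal_matrices)
    ultimately have "bounded ((\<lambda>x. g (?f x)) ` (?O \<times> ?O))"
      by (intro compact_imp_bounded compact_continuous_image)
    then obtain K where K: "\<forall>y \<in> (\<lambda>x. g (?f x)) ` (?O \<times> ?O). norm y \<le> K"
      unfolding bounded_iff by blast
    have [measurable]: "g \<in> borel_measurable borel"
      using g by (rule borel_measurable_continuous_onI)
    have "integrable haar_pair (\<lambda>x. g (case x of (R, Q) \<Rightarrow> R ** B ** Q))"
      by (rule haar2.integrable_const_bound[of _ K], use AE_haar_pair in eventually_elim)
         (use K in \<open>auto simp: case_prod_unfold\<close>)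
    thus "integrable (rotated_law B) g"
      unfolding rotated_law_def by (subst integrable_distr_eq) auto
  qed
qed

lemma integral_sum_sq_minors_rotated:
  fixes B :: "real^'n^'n"
  assumes "k \<le> CARD('n)"
  shows "(\<integral>C. sum_sq_minors k C \<partial>rotated_law B) = sum_sq_minors k B"
proof -
  have cont: "continuous_on UNIV (sum_sq_minors k :: real^'n^'n \<Rightarrow> real)"
    unfolding sum_sq_minors_def case_prod_unfold
    by (intro continuous_on_sum continuous_on_power continuous_on_minor)
  have "(\<integral>C. sum_sq_minors k C \<partial>rotated_law B) =
      (\<integral>x. sum_sq_minors k (case x of (R, Q) \<Rightarrow> R ** B ** Q) \<partial>haar_pair)"
    unfolding rotated_law_def using cont
    by (intro integral_distr) (auto intro: borel_measurable_continuous_onI)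
  \<comment> \<open>The integrand is constant on orthogonal pairs, hence almost everywhere.\<close>
  also have "\<dots> = (\<integral>x. sum_sq_minors k B \<partial>(haar_pair :: ((real^'n^'n) \<times> _) measure))"
    using cont AE_haar_pair assms
    by (intro integral_cong_AE) (auto intro!: measurable_compose[OF measurable_rotate] borel_measurable_continuous_onI
        simp: sum_sq_minors_orthogonal elim!: eventually_mono)
  also have "\<dots> = sum_sq_minors k B" by (simp add: haar2.prob_space)
  finally show ?thesis .
qed

lemma expected_charpoly_eq:
  fixes A B :: "real^'n^'n"
  shows "expected_charpoly A B = (\<Sum>k\<le>CARD('n). monom ((-1) ^ k *
    (\<integral>C. sum_sq_minors k (A + C) \<partial>rotated_law B)) (CARD('n) - k))"
proof -
  let ?d = "CARD('n)"
  let ?H2 = "(haar_pair :: ((real^'n^'n) \<times> _) measure)"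
  let ?M = "\<lambda>x. A + fst x ** B ** snd x"
  have cont: "continuous_on UNIV (\<lambda>C :: real^'n^'n. sum_sq_minors k (A + C))" for k
    unfolding sum_sq_minors_def case_prod_unfold
    by (intro continuous_on_sum continuous_on_power continuous_on_compose2[OF continuous_on_minor])
      (auto intro!: continuous_intros)
  have "expected_charpoly A B = (\<Sum>k\<le>?d. monom (\<integral>x. coeff (charpoly (?M x ** transpose (?M x))) k \<partial>?H2) k)"
    by (simp add: expected_charpoly_def expectation_poly_def case_prod_unfold)
  \<comment> \<open>The expectation is indexed by exponents, the Gram formula by sizes of minors;
    the sum is reversed to match.\<close>
  also have "\<dots> = (\<Sum>k\<le>?d. monom (\<integral>x. coeff (charpoly (?M x ** transpose (?M x))) (?d - k) \<partial>?H2) (?d - k))"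
    by (rule sum.reindex_bij_witness[of _ "\<lambda>k. ?d - k" "\<lambda>k. ?d - k"]) auto
  also have "\<dots> = (\<Sum>k\<le>?d. monom ((-1) ^ k *
    (\<integral>C. sum_sq_minors k (A + C) \<partial>rotated_law B)) (?d - k))"
  proof (rule sum.cong[OF refl])
    fix k assume "k \<in> {..?d}"
    hence "(\<integral>x. coeff (charpoly (?M x ** transpose (?M x))) (?d - k) \<partial>?H2) =
        (\<integral>x. (-1) ^ k * sum_sq_minors k (?M x) \<partial>?H2)"
      by (simp add: coeff_charpoly_gram)
    also have "\<dots> = (-1) ^ k * (\<integral>x. sum_sq_minors k (A + (case x of (R, Q) \<Rightarrow> R ** B ** Q)) \<partial>?H2)"
      by (simp add: case_prod_unfold)
    also have "(\<integral>x. sum_sq_minors k (A + (case x of (R, Q) \<Rightarrow> R ** B ** Q)) \<partial>?H2) =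
        (\<integral>C. sum_sq_minors k (A + C) \<partial>rotated_law B)"
      unfolding rotated_law_def using cont
      by (intro integral_distr[symmetric]) (auto intro: borel_measurable_continuous_onI)
    finally show "monom (\<integral>x. coeff (charpoly (?M x ** transpose (?M x))) (?d - k) \<partial>?H2) (?d - k) =
      monom ((-1) ^ k * (\<integral>C. sum_sq_minors k (A + C) \<partial>rotated_law B)) (?d - k)" by simp
  qed
  finally show ?thesis .
qed

end

section \<open>The explicit formula for the expected characteristic polynomial\<close>

lemma choose_ratio:
  assumes "i + j \<le> d"
  shows "real ((d - i) choose j) / real (d choose j) =
    (fact (d - i) * fact (d - j)) / (fact d * fact (d - i - j))"
  \<comment> \<open>Both binomial coefficients contain \<open>fact j\<close> in the denominator, and
    it cancels.\<close>
  using assms by (simp add: binomial_fact)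

text \<open>The right-hand side involves \<open>A\<close> and \<open>B\<close> only through the
  coefficients of their Gram characteristic polynomials. This makes the convolution independent of
  the chosen matrices.\<close>

lemma expected_charpoly_formula:
  fixes A B :: "real^'n^'n"
  shows "expected_charpoly A B = (\<Sum>k\<le>CARD('n). monom ((-1) ^ k * (\<Sum>(i, j) \<in> {(i, j). i + j = k}.
       ((fact (CARD('n) - i) * fact (CARD('n) - j)) / (fact CARD('n) * fact (CARD('n) - i - j)))\<^sup>2 *
         sum_sq_minors i A * sum_sq_minors j B)) (CARD('n) - k))"
  unfolding expected_charpoly_eq
proof (rule sum.cong[OF refl])
  interpret biinvariant_law "rotated_law B" by (rule biinvariant_rotated_law)
  let ?d = "CARD('n)"
  fix k assume k: "k \<in> {..?d}"
  have "(\<integral>C. sum_sq_minors k (A + C) \<partial>rotated_law B) =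
    (\<Sum>i\<le>k. (real ((?d - i) choose (k - i)) / real (?d choose (k - i)))\<^sup>2 *
      sum_sq_minors i A * (\<integral>C. sum_sq_minors (k - i) C \<partial>rotated_law B))"
    by (rule integral_sum_sq_minors_add)
  also have "\<dots> = (\<Sum>i\<le>k. ((fact (?d - i) * fact (?d - (k - i))) / (fact ?d * fact (?d - i - (k - i))))\<^sup>2 *
      sum_sq_minors i A * sum_sq_minors (k - i) B)"
    using k by (intro sum.cong refl) (simp add: integral_sum_sq_minors_rotated choose_ratio)
  also have "\<dots> = (\<Sum>(i, j) \<in> {(i, j). i + j = k}.
       ((fact (?d - i) * fact (?d - j)) / (fact ?d * fact (?d - i - j)))\<^sup>2 *
         sum_sq_minors i A * sum_sq_minors j B)"
    by (rule sum.reindex_bij_witness[of _ fst "\<lambda>i. (i, k - i)"]) auto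
  finally show "monom ((-1) ^ k * (\<integral>C. sum_sq_minors k (A + C) \<partial>rotated_law B)) (?d - k) =
     monom ((-1) ^ k * (\<Sum>(i, j) \<in> {(i, j). i + j = k}.
       ((fact (?d - i) * fact (?d - j)) / (fact ?d * fact (?d - i - j)))\<^sup>2 *
         sum_sq_minors i A * sum_sq_minors j B)) (?d - k)" by simp
qed

text \<open>A diagonal matrix of square roots of the roots of \<open>p\<close> works. The roots are
  obtained by splitting \<open>p\<close> over the complex numbers, and the hypothesis puts them all
  on the nonnegative real axis.\<close>

lemma exists_gram_charpoly:
  fixes p :: "real poly"
  assumes deg: "degree p = CARD('n::finite)" and lc: "lead_coeff p = 1"
    and roots: "\<And>z :: complex. poly (map_poly of_real p) z = 0 \<Longrightarrow> z \<in> \<real>\<^sub>\<ge>\<^sub>0"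
  obtains A :: "real^'n^'n" where "charpoly (A ** transpose A) = p"
proof -
  define P where "P = map_poly complex_of_real p"
  have degP: "degree P = CARD('n)" and lcP: "lead_coeff P = 1"
    using deg lc by (simp_all add: P_def degree_map_poly coeff_map_poly)
  obtain xs where xs: "mset xs = proots P" using ex_mset by blast
  have P0: "P \<noteq> 0" using lcP by auto
  have len: "length xs = CARD('n)"
    using size_proots_complex[of P] degP xs by (metis size_mset)
  have prodP: "P = (\<Prod>z\<leftarrow>xs. [:-z, 1:])"
  proof -
    have "P = (\<Prod>z\<in>#proots P. [:-z, 1:])"
      using complex_poly_decompose_multiset[of P] lcP by simp
    also have "\<dots> = (\<Prod>z\<in>#mset xs. [:-z, 1:])" by (simp add: xs)
    also have "\<dots> = (\<Prod>z\<leftarrow>xs. [:-z, 1:])"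
      by (metis mset_map prod_mset_prod_list)
    finally show ?thesis .
  qed
  obtain e :: "'n \<Rightarrow> nat" where e: "bij_betw e UNIV {..<CARD('n)}"
    using ex_bij_betw_finite_nat[of "UNIV :: 'n set"] by (auto simp: atLeast0LessThan)
  \<comment> \<open>Numbering the index type by \<open>e\<close> attaches one root to each index,
    with multiplicity.\<close>
  define r where "r i = Re (xs ! e i)" for i
  have r: "xs ! e i = complex_of_real (r i)" "r i \<ge> 0" for i
  proof -
    have "e i < length xs" using e len by (auto simp: bij_betw_def)
    hence "xs ! e i \<in># proots P" using xs by (metis nth_mem set_mset_mset)
    hence "poly P (xs ! e i) = 0" using P0 by simp
    hence "xs ! e i \<in> \<real>\<^sub>\<ge>\<^sub>0" using roots by (simp add: P_def)
    thus "xs ! e i = complex_of_real (r i)" "r i \<ge> 0"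
      by (auto simp: r_def nonneg_Reals_def)
  qed
  have poly_p: "poly p x = (\<Prod>i\<in>UNIV. x - r i)" for x
  proof -
    have "complex_of_real (poly p x) = poly P (of_real x)"
      unfolding P_def by (induction p) (auto simp: map_poly_pCons)
    also have "\<dots> = (\<Prod>z\<leftarrow>xs. of_real x - z)"
      unfolding prodP by (induction xs) (auto simp: algebra_simps)
    also have "\<dots> = (\<Prod>k<CARD('n). of_real x - xs ! k)"
      by (simp add: prod.list_conv_set_nth len atLeast0LessThan)
    also have "\<dots> = (\<Prod>i\<in>UNIV. of_real x - xs ! e i)"
      using prod.reindex_bij_betw[OF e, of "\<lambda>k. of_real x - xs ! k"] by simp
    also have "\<dots> = of_real (\<Prod>i\<in>UNIV. x - r i)"
      by (simp add: r)
    finally show ?thesis by (simp only: of_real_eq_iff)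
  qed
  define A :: "real^'n^'n" where "A = (\<chi> i j. if i = j then sqrt (r i) else 0)"
  have AA: "(A ** transpose A) $ i $ j = (if i = j then r i else 0)" for i j
    using r(2) by (simp add: A_def matrix_matrix_mult_def transpose_def if_distrib[where f = "\<lambda>y. y * _"] cong: if_cong)
  have "charpoly (A ** transpose A) = p"
  proof (rule poly_eq_poly_eq_iff[THEN iffD1], rule ext)
    fix x
    have "det (mat x - A ** transpose A) = (\<Prod>i\<in>UNIV. (mat x - A ** transpose A) $ i $ i)"
      by (rule det_diagonal) (simp add: AA mat_def)
    also have "\<dots> = poly p x" by (simp add: AA mat_def poly_p)
    finally show "poly (charpoly (A ** transpose A)) x = poly p x" by (simp add: poly_charpoly)
  qed
  thus thesis by (rule that)
qed

lemma sum_sq_minors_eq_coeff: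
  fixes A :: "real^'n^'n"
  assumes "charpoly (A ** transpose A) = (\<Sum>i\<le>CARD('n). monom ((-1) ^ i * a i) (CARD('n) - i))"
    and "k \<le> CARD('n)"
  shows "sum_sq_minors k A = a k"
proof -
  have "coeff (\<Sum>i\<le>CARD('n). monom ((-1) ^ i * a i) (CARD('n) - i)) (CARD('n) - k) =
      (\<Sum>i\<le>CARD('n). if i = k then (-1) ^ k * a k else 0)"
    unfolding coeff_sum using assms(2) by (intro sum.cong) auto
  also have "\<dots> = (-1) ^ k * a k" using assms(2) by simp
  finally show ?thesis using coeff_charpoly_gram[OF assms(2), of A] assms(1) by simp
qed

theorem theorem1p3:
  fixes p q :: "real poly" and a b :: "nat \<Rightarrow> real"
  defines "d \<equiv> CARD('n::finite)"
  assumes p: "p = (\<Sum>i\<le>d. monom ((-1) ^ i * a i) (d - i))"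
    and q: "q = (\<Sum>i\<le>d. monom ((-1) ^ i * b i) (d - i))"
    and "degree p = d" and "lead_coeff p = 1"
    and "degree q = d" and "lead_coeff q = 1"
    and "\<And>z :: complex. poly (map_poly of_real p) z = 0 \<Longrightarrow> z \<in> \<real>\<^sub>\<ge>\<^sub>0"
    and "\<And>z :: complex. poly (map_poly of_real q) z = 0 \<Longrightarrow> z \<in> \<real>\<^sub>\<ge>\<^sub>0"
  shows "asym_add_conv TYPE('n) p q =
    (\<Sum>k\<le>d. monom ((-1) ^ k * (\<Sum>(i, j) \<in> {(i, j). i + j = k}.
       ((fact (d - i) * fact (d - j)) / (fact d * fact (d - i - j)))\<^sup>2 * a i * b j)) (d - k))"
    (is "_ = ?rhs")
proof -
  \<comment> \<open>Every admissible pair gives the same value, which is the uniqueness required by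
    the description operator.\<close>
  have formula: "expected_charpoly A B = ?rhs"
    if A: "charpoly (A ** transpose A) = p" and B: "charpoly (B ** transpose B) = q"
    for A B :: "real^'n^'n"
  proof -
    \<comment> \<open>Indices up to \<open>d\<close> suffice, because \<open>i + j = k\<close> with
      \<open>k \<le> d\<close> bounds both.\<close>
    have a: "sum_sq_minors i A = a i" and b: "sum_sq_minors i B = b i" if "i \<le> d" for i
      using sum_sq_minors_eq_coeff[of A a i] sum_sq_minors_eq_coeff[of B b i] A B p q that
      by (simp_all add: d_def)
    show ?thesis
      unfolding expected_charpoly_formula d_def[symmetric]
      by (intro sum.cong refl arg_cong2[where f = monom] arg_cong2[where f = "(*)"])
        (auto simp: a b)
  qed
  \<comment> \<open>Nonnegativity of the roots enters here, to show that admissible matrices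
    exist.\<close>
  obtain A :: "real^'n^'n" where A: "charpoly (A ** transpose A) = p"
    using exists_gram_charpoly[of p] assms unfolding d_def by blast
  obtain B :: "real^'n^'n" where B: "charpoly (B ** transpose B) = q"
    using exists_gram_charpoly[of q] assms unfolding d_def by blast
  show ?thesis
    unfolding asym_add_conv_def
  proof (rule the_equality)
    show "\<exists>A B :: real^'n^'n. charpoly (A ** transpose A) = p \<and> charpoly (B ** transpose B) = q \<and>
        ?rhs = expected_charpoly A B"
      by (intro exI conjI, rule A, rule B, rule formula[OF A B, symmetric])
  next
    fix r
    assume "\<exists>A B :: real^'n^'n. charpoly (A ** transpose A) = p \<and> charpoly (B ** transpose B) = q \<and>
        r = expected_charpoly A B"
    then obtain A B :: "real^'n^'n" where AB: "charpoly (A ** transpose A) = p"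
      "charpoly (B ** transpose B) = q" and r: "r = expected_charpoly A B" by blast
    show "r = ?rhs" unfolding r by (rule formula[OF AB])
  qed
qed

end
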